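(* Let $H$ be a complex Hilbert space, let $B$ be a bounded self-adjoint operator on $H$ (everywhere defined), and let $A$ be an unbounded self-adjoint operator in $H$ which is positive. Assume that $AB$ is normal. Then both $\overline{BA}$ and $AB$ are self-adjoint. Moreover, $AB=\overline{BA}$ (as unbounded operators, including equality of domains).
   Context: Products carry their natural domains: $D(BA)=D(A)$ and $D(AB)=\{x\in H: Bx\in D(A)\}$. A densely defined operator $T$ is normal if it is closed and $TT^*=T^*T$ (including equality of domains), and self-adjoint if $T=T^*$; a normal operator is in particular densely defined. $\overline{T}$ denotes the closure of a closable operator $T$. Positive means nonnegative: $\langle Ax,x\rangle\ge 0$ for all $x\in D(A)$. *)

theory Defs
  imports "HOL-Analysis.Analysis"
begin

section \<open>Complex Hilbert spaces\<close>

text \<open>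
  The inner product \<open>cinner\<close> is linear in its first argument. Building on \<^class>\<open>real_inner\<close>
  is no restriction: every complex inner product space is a real one under the real part of its
  inner product, with the same norm.
\<close>

class complex_inner = real_inner +
  fixes scaleC :: "complex \<Rightarrow> 'a \<Rightarrow> 'a" (infixr \<open>*\<^sub>C\<close> 75)
    and cinner :: "'a \<Rightarrow> 'a \<Rightarrow> complex"
  assumes scaleC_add_right: "a *\<^sub>C (x + y) = a *\<^sub>C x + a *\<^sub>C y"
    and scaleC_add_left: "(a + b) *\<^sub>C x = a *\<^sub>C x + b *\<^sub>C x"
    and scaleC_scaleC: "a *\<^sub>C (b *\<^sub>C x) = (a * b) *\<^sub>C x"
    and scaleR_eq_scaleC: "scaleR r x = complex_of_real r *\<^sub>C x"
    and cinner_commute: "cinner x y = cnj (cinner y x)"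
    and cinner_add_left: "cinner (x + y) z = cinner x z + cinner y z"
    and cinner_scaleC_left: "cinner (a *\<^sub>C x) y = a * cinner x y"
    and inner_eq_Re_cinner: "inner x y = Re (cinner x y)"

class chilbert_space = complex_inner + banach

lemma scaleC_one: "1 *\<^sub>C x = (x :: 'a :: complex_inner)"
  using scaleR_eq_scaleC[of 1 x] by simp

lemma cinner_self: "cinner x x = complex_of_real ((norm x)\<^sup>2)"
  for x :: "'a :: complex_inner"
proof -
  have "Im (cinner x x) = 0"
    using arg_cong[OF cinner_commute[of x x], of Im] by simp
  moreover have "Re (cinner x x) = (norm x)\<^sup>2"
    by (simp add: power2_norm_eq_inner inner_eq_Re_cinner)
  ultimately show ?thesis by (simp add: complex_eq_iff)
qed

instantiation complex :: chilbert_space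
begin
definition scaleC_complex :: "complex \<Rightarrow> complex \<Rightarrow> complex" where "scaleC_complex = (*)"
definition cinner_complex :: "complex \<Rightarrow> complex \<Rightarrow> complex" where "cinner_complex x y = x * cnj y"
instance
  by standard
    (auto simp: scaleC_complex_def cinner_complex_def inner_complex_def algebra_simps
      scaleR_conv_of_real)
end


section \<open>Unbounded operators\<close>

text \<open>
  An operator in \<open>H\<close> is a partial map \<open>T\<close> with domain \<^term>\<open>dom T\<close> and value \<^term>\<open>the (T x)\<close> at
  \<open>x\<close> in the domain. Equality of partial maps includes equality of domains, and \<^term>\<open>S \<circ>\<^sub>m T\<close> is
  the product \<open>ST\<close> on its natural domain, cf. \<open>dom_operator_product\<close>. An ``unbounded'' operator
  is one that need not be bounded.
\<close>

definition linear_operator :: "('a::complex_inner \<rightharpoonup> 'a) \<Rightarrow> bool" where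
  "linear_operator T \<longleftrightarrow>
     0 \<in> dom T \<and>
     (\<forall>x\<in>dom T. \<forall>y\<in>dom T. T (x + y) = Some (the (T x) + the (T y))) \<and>
     (\<forall>c. \<forall>x\<in>dom T. T (c *\<^sub>C x) = Some (c *\<^sub>C the (T x)))"

definition bounded_operator :: "('a::complex_inner \<rightharpoonup> 'a) \<Rightarrow> bool" where
  "bounded_operator T \<longleftrightarrow>
     linear_operator T \<and> dom T = UNIV \<and> (\<exists>K. \<forall>x. norm (the (T x)) \<le> K * norm x)"

definition densely_defined :: "('a::complex_inner \<rightharpoonup> 'a) \<Rightarrow> bool" where
  "densely_defined T \<longleftrightarrow> closure (dom T) = UNIV"

definition closed_operator :: "('a::complex_inner \<rightharpoonup> 'a) \<Rightarrow> bool" where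
  "closed_operator T \<longleftrightarrow> closed (Map.graph T)"

definition closable :: "('a::complex_inner \<rightharpoonup> 'a) \<Rightarrow> bool" where
  "closable T \<longleftrightarrow> single_valued (closure (Map.graph T))"

text \<open>Only meaningful for closable \<open>T\<close>.\<close>
definition operator_closure :: "('a::complex_inner \<rightharpoonup> 'a) \<Rightarrow> ('a \<rightharpoonup> 'a)" where
  "operator_closure T = (\<lambda>x.
     if \<exists>y. (x, y) \<in> closure (Map.graph T)
     then Some (THE y. (x, y) \<in> closure (Map.graph T)) else None)"

text \<open>Only meaningful for densely defined \<open>T\<close>, where the \<open>z\<close> below is unique.\<close>
definition adjoint_operator :: "('a::complex_inner \<rightharpoonup> 'a) \<Rightarrow> ('a \<rightharpoonup> 'a)" where
  "adjoint_operator T = (\<lambda>y.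
     if \<exists>z. \<forall>x\<in>dom T. cinner (the (T x)) y = cinner x z
     then Some (THE z. \<forall>x\<in>dom T. cinner (the (T x)) y = cinner x z) else None)"

definition self_adjoint :: "('a::complex_inner \<rightharpoonup> 'a) \<Rightarrow> bool" where
  "self_adjoint T \<longleftrightarrow> linear_operator T \<and> densely_defined T \<and> T = adjoint_operator T"

definition normal_operator :: "('a::complex_inner \<rightharpoonup> 'a) \<Rightarrow> bool" where
  "normal_operator T \<longleftrightarrow>
     linear_operator T \<and> densely_defined T \<and> closed_operator T \<and>
     T \<circ>\<^sub>m adjoint_operator T = adjoint_operator T \<circ>\<^sub>m T"

definition positive_operator :: "('a::complex_inner \<rightharpoonup> 'a) \<Rightarrow> bool" where
  "positive_operator T \<longleftrightarrow> (\<forall>x\<in>dom T. cinner (the (T x)) x \<in> \<real>\<^sub>\<ge>\<^sub>0)"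

lemma dom_operator_product: "dom (S \<circ>\<^sub>m T) = {x \<in> dom T. the (T x) \<in> dom S}"
  by (auto simp: dom_def map_comp_def split: option.splits)

lemma graph_operator_closure:
  assumes "closable T"
  shows "Map.graph (operator_closure T) = closure (Map.graph T)"
proof -
  have the_eq: "(THE y. (x, y) \<in> closure (Map.graph T)) = y"
    if "(x, y) \<in> closure (Map.graph T)" for x y
    using that assms unfolding closable_def single_valued_def by blast
  show ?thesis
    by (subst (1) Map.graph_def) (auto simp: operator_closure_def the_eq split: if_splits)
qed

lemma adjoint_operator_eq_Some_iff:
  assumes "densely_defined T"
  shows "adjoint_operator T y = Some z \<longleftrightarrow> (\<forall>x\<in>dom T. cinner (the (T x)) y = cinner x z)"
proof -
  have unique: "z = w"
    if z: "\<forall>x\<in>dom T. cinner (the (T x)) y = cinner x z"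
      and w: "\<forall>x\<in>dom T. cinner (the (T x)) y = cinner x w" for z w
  proof -
    have "dom T \<subseteq> {x. inner x (z - w) = 0}"
    proof
      fix x assume "x \<in> dom T"
      then have "cinner x z = cinner x w" using z w by metis
      then show "x \<in> {x. inner x (z - w) = 0}"
        unfolding inner_diff_right mem_Collect_eq by (simp add: inner_eq_Re_cinner)
    qed
    moreover have "closed {x. inner x (z - w) = 0}"
      by (intro closed_Collect_eq continuous_intros)
    ultimately have "closure (dom T) \<subseteq> {x. inner x (z - w) = 0}"
      by (rule closure_minimal)
    then have "inner (z - w) (z - w) = 0"
      using assms unfolding densely_defined_def by blast
    then show ?thesis by simp
  qed
  define P where "P = (\<lambda>z. \<forall>x\<in>dom T. cinner (the (T x)) y = cinner x z)"
  have "(THE z. P z) = z" if "P z" for z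
    using that unique unfolding P_def by (intro the_equality) blast+
  then have "(if \<exists>z. P z then Some (THE z. P z) else None) = Some z \<longleftrightarrow> P z"
    by auto
  then show ?thesis
    unfolding adjoint_operator_def P_def .
qed

end

theory Submission
  imports Defs
begin

text \<open>
  Write \<open>n = AB\<close>. The form \<open>h x y = \<langle>B x, n y\<rangle>\<close> is positive semidefinite because \<open>A\<close> is positive, and
  \<open>n\<close> is symmetric for \<open>h\<close>, so \<open>(n - \<i>\<beta>)\<^sup>k\<close> stretches the \<open>h\<close>-seminorm at least by \<open>\<bar>\<beta>\<bar>\<^sup>k\<close>. On the
  spectral subspace of the normal operator \<open>n\<close> for a disc of radius \<open>\<epsilon> < \<bar>\<beta>\<bar>\<close> about \<open>\<i>\<beta>\<close> the
  norm grows at most by \<open>\<epsilon>\<^sup>k\<close>, and \<open>h\<close> is bounded there by the norm. Hence \<open>h\<close> vanishes on this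
  subspace, so does \<open>n\<close>, and the subspace is trivial. Thus \<open>\<parallel>(n - \<i>\<beta>) x\<parallel> \<ge> \<bar>\<beta>\<bar> \<parallel>x\<parallel>\<close> for all real
  \<open>\<beta>\<close>; letting \<open>\<beta> \<rightarrow> \<plusminus>\<infinity>\<close> shows that \<open>\<langle>n x, x\<rangle>\<close> is real, and a symmetric normal operator is
  self-adjoint. This avoids the spectral theorem and Fuglede's theorem: the spectral subspace
  is the kernel of \<open>\<bar>S\<bar> - S\<close> for a bounded self-adjoint \<open>S\<close> built from a resolvent.
\<close>

section \<open>Complex inner products\<close>

lemma cinner_add_right: "cinner x (y + z) = cinner x y + cinner x (z :: 'a::complex_inner)"
  by (metis cinner_commute cinner_add_left complex_cnj_add)

lemma cinner_scaleC_right: "cinner x (a *\<^sub>C y) = cnj a * cinner x (y :: 'a::complex_inner)"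
  by (metis cinner_commute cinner_scaleC_left complex_cnj_mult)

lemma scaleC_minus_one: "(- 1) *\<^sub>C x = - (x :: 'a::complex_inner)"
  using scaleR_eq_scaleC[of "-1" x] by simp

lemma cinner_minus_left: "cinner (- x) y = - cinner x (y :: 'a::complex_inner)"
  by (metis cinner_scaleC_left scaleC_minus_one mult_minus1)

lemma cinner_diff_left: "cinner (x - y) z = cinner x z - cinner y (z :: 'a::complex_inner)"
  using cinner_add_left[of x "- y" z] by (simp add: cinner_minus_left)

lemma cinner_diff_right: "cinner x (y - z) = cinner x y - cinner x (z :: 'a::complex_inner)"
  by (metis cinner_commute cinner_diff_left complex_cnj_diff)

text \<open>Rotating the second argument by \<open>\<i>\<close> exposes the imaginary part. Real
  identities that hold on a set closed under multiplication by \<open>\<i>\<close> thereby become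
  complex ones.\<close>

lemma cinner_eq_Complex: "cinner x y = Complex (inner x y) (inner x (\<i> *\<^sub>C y))"
  by (simp add: complex_eq_iff inner_eq_Re_cinner cinner_scaleC_right)

lemma inner_ii_ii: "inner (\<i> *\<^sub>C x) (\<i> *\<^sub>C y) = inner x (y :: 'a::complex_inner)"
  by (simp add: inner_eq_Re_cinner cinner_scaleC_right cinner_scaleC_left)

lemma cinner_zero_right: "cinner x 0 = (0 :: complex)"
  using cinner_diff_right[of x 0 0] by simp

lemma scaleC_diff_right: "a *\<^sub>C (x - y) = a *\<^sub>C x - a *\<^sub>C (y :: 'a::complex_inner)"
  using scaleC_add_right[of a "x - y" y] by simp

lemma norm_scaleC: "norm (a *\<^sub>C x) = cmod a * norm (x :: 'a::complex_inner)"
proof -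
  have "complex_of_real ((norm (a *\<^sub>C x))\<^sup>2) = a * cnj a * cinner x x"
    unfolding cinner_self[symmetric] by (simp add: cinner_scaleC_left cinner_scaleC_right)
  also have "\<dots> = complex_of_real ((cmod a * norm x)\<^sup>2)"
    by (simp add: cinner_self complex_norm_square[symmetric] power_mult_distrib)
  finally have "(norm (a *\<^sub>C x))\<^sup>2 = (cmod a * norm x)\<^sup>2"
    using of_real_eq_iff by blast
  then show ?thesis by (simp add: power2_eq_iff_nonneg)
qed

lemma bounded_linear_scaleC: "bounded_linear (\<lambda>x :: 'a::complex_inner. a *\<^sub>C x)"
proof (rule bounded_linear_intro)
  show "a *\<^sub>C (x + y) = a *\<^sub>C x + a *\<^sub>C y" for x y :: 'a by (rule scaleC_add_right)
  show "a *\<^sub>C r *\<^sub>R x = r *\<^sub>R a *\<^sub>C x" for r and x :: 'a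
    by (simp add: scaleR_eq_scaleC scaleC_scaleC mult.commute)
  show "norm (a *\<^sub>C x) \<le> norm x * cmod a" for x :: 'a by (simp add: norm_scaleC)
qed

section \<open>Orthogonal projections\<close>

text \<open>A minimizing sequence for the distance to \<open>V\<close> is Cauchy. The sort is real
  and general so that graphs inside \<open>'a \<times> 'a\<close> are covered.\<close>

lemma orthogonal_projection_exists:
  fixes V :: "'b::{real_inner, complete_space} set"
  assumes V: "subspace V" "closed V"
  shows "\<exists>p\<in>V. \<forall>w\<in>V. inner (u - p) w = 0"
proof -
  define d where "d = Inf ((\<lambda>v. (norm (u - v))\<^sup>2) ` V)"
  have V0: "0 \<in> V" using V(1) by (rule subspace_0)
  have bdd: "bdd_below ((\<lambda>v. (norm (u - v))\<^sup>2) ` V)"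
    by (rule bdd_belowI2[of _ 0]) simp
  have d_le: "d \<le> (norm (u - v))\<^sup>2" if "v \<in> V" for v
    unfolding d_def by (rule cINF_lower[OF bdd that])
  have "\<exists>v\<in>V. (norm (u - v))\<^sup>2 < d + 1 / real (Suc n)" for n
  proof -
    have "d < d + 1 / real (Suc n)" by simp
    then show ?thesis unfolding d_def using cINF_less_iff[OF _ bdd] V0 by blast
  qed
  then obtain v where v: "\<And>n. v n \<in> V" "\<And>n. (norm (u - v n))\<^sup>2 < d + 1 / real (Suc n)"
    by metis
  \<comment> \<open>Parallelogram law for \<open>u - x\<close> and \<open>u - y\<close>: the
    midpoint of \<open>x\<close> and \<open>y\<close> lies in \<open>V\<close>, so its squared
    distance to \<open>u\<close> is at least \<open>d\<close>.\<close>
  have par: "(norm (x - y))\<^sup>2 \<le> 2 * (norm (u - x))\<^sup>2 + 2 * (norm (u - y))\<^sup>2 - 4 * d"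
    if "x \<in> V" "y \<in> V" for x y
  proof -
    have "(1 / 2) *\<^sub>R (x + y) \<in> V" using V(1) that by (intro subspace_mul subspace_add)
    from d_le[OF this] have "4 * d \<le> 4 * (norm (u - (1 / 2) *\<^sub>R (x + y)))\<^sup>2" by simp
    also have "\<dots> = 2 * (norm (u - x))\<^sup>2 + 2 * (norm (u - y))\<^sup>2 - (norm (x - y))\<^sup>2"
      by (simp add: power2_norm_eq_inner inner_diff_left inner_diff_right inner_add_left
          inner_add_right inner_commute algebra_simps)
    finally show ?thesis by simp
  qed
  have "Cauchy v"
  proof (rule metric_CauchyI)
    fix e :: real assume "0 < e"
    then obtain M where M: "4 / e\<^sup>2 < real M" using reals_Archimedean2 by blast
    have "dist (v m) (v n) < e" if mn: "m \<ge> M" "n \<ge> M" for m n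
    proof -
      have "0 < 4 / e\<^sup>2" using \<open>0 < e\<close> by simp
      then have M0: "real M > 0" using M by linarith
      have "1 / real (Suc m) \<le> 1 / real M" "1 / real (Suc n) \<le> 1 / real M"
        using mn M0 by (simp_all add: frac_le)
      then have "(norm (v m - v n))\<^sup>2 < 4 * (1 / real M)"
        using par[OF v(1)[of m] v(1)[of n]] v(2)[of m] v(2)[of n] by linarith
      also have "\<dots> < e\<^sup>2" using M M0 \<open>0 < e\<close> by (simp add: field_simps)
      finally show ?thesis using \<open>0 < e\<close> by (simp add: dist_norm power2_less_imp_less)
    qed
    then show "\<exists>M. \<forall>m\<ge>M. \<forall>n\<ge>M. dist (v m) (v n) < e" by blast
  qed
  then obtain p where p: "v \<longlonglongrightarrow> p" by (auto simp: Cauchy_convergent_iff convergent_def)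
  have pV: "p \<in> V" using V(2) v(1) p by (rule closed_sequentially)
  have "(\<lambda>n. (norm (u - v n))\<^sup>2) \<longlonglongrightarrow> (norm (u - p))\<^sup>2"
    by (intro tendsto_intros p)
  moreover have "(\<lambda>n. d + 1 / real (Suc n)) \<longlonglongrightarrow> d + 0"
    by (intro tendsto_intros LIMSEQ_Suc[OF lim_1_over_n])
  ultimately have pd: "(norm (u - p))\<^sup>2 \<le> d"
    using v(2) by (intro LIMSEQ_le[of "\<lambda>n. (norm (u - v n))\<^sup>2" _ "\<lambda>n. d + 1 / real (Suc n)"])
      (auto intro: less_imp_le)
  have "inner (u - p) w = 0" if w: "w \<in> V" for w
  proof (rule ccontr)
    define c where "c = inner (u - p) w"
    assume "inner (u - p) w \<noteq> 0"
    then have c: "c \<noteq> 0" by (simp add: c_def)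
    then have "w \<noteq> 0" by (auto simp: c_def)
    \<comment> \<open>The minimizer of the quadratic polynomial
      \<open>(norm (u - (p + s *\<^sub>R w)))\<^sup>2\<close> in \<open>s\<close>; for
      \<open>c \<noteq> 0\<close> it would beat the minimal distance.\<close>
    define s where "s = c / inner w w"
    have ww: "inner w w > 0" using \<open>w \<noteq> 0\<close> by simp
    have "p + s *\<^sub>R w \<in> V" using V(1) pV w by (intro subspace_add subspace_mul)
    then have "(norm (u - p))\<^sup>2 \<le> (norm (u - (p + s *\<^sub>R w)))\<^sup>2" by (rule order_trans[OF pd d_le])
    also have "\<dots> = (norm (u - p))\<^sup>2 - 2 * s * c + s * s * inner w w"
      by (simp add: c_def power2_norm_eq_inner inner_diff_left inner_diff_right inner_add_left
          inner_add_right inner_commute algebra_simps)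
    also have "\<dots> = (norm (u - p))\<^sup>2 - c\<^sup>2 / inner w w"
      using ww by (simp add: s_def field_simps power2_eq_square)
    finally have "c\<^sup>2 / inner w w \<le> 0" by simp
    moreover have "c\<^sup>2 / inner w w > 0" using c ww by (intro divide_pos_pos) auto
    ultimately show False by linarith
  qed
  with pV show ?thesis by blast
qed

lemma subspace_closure:
  fixes V :: "'b::real_normed_vector set"
  assumes "subspace V"
  shows "subspace (closure V)"
proof (rule subspaceI)
  show "0 \<in> closure V" using subspace_0[OF assms] closure_subset by blast
  show "x + y \<in> closure V" if "x \<in> closure V" "y \<in> closure V" for x y
  proof -
    obtain f where "\<And>n. f n \<in> V" "f \<longlonglongrightarrow> x"
      using \<open>x \<in> closure V\<close> by (auto simp: closure_sequential)
    moreover obtain g where "\<And>n. g n \<in> V" "g \<longlonglongrightarrow> y"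
      using \<open>y \<in> closure V\<close> by (auto simp: closure_sequential)
    ultimately have "\<forall>n. f n + g n \<in> V" "(\<lambda>n. f n + g n) \<longlonglongrightarrow> x + y"
      by (simp_all add: subspace_add[OF assms] tendsto_add)
    then show ?thesis unfolding closure_sequential by (intro exI conjI)
  qed
  show "c *\<^sub>R x \<in> closure V" if "x \<in> closure V" for c x
  proof -
    obtain f where "\<And>n. f n \<in> V" "f \<longlonglongrightarrow> x"
      using \<open>x \<in> closure V\<close> by (auto simp: closure_sequential)
    then have "\<forall>n. c *\<^sub>R f n \<in> V" "(\<lambda>n. c *\<^sub>R f n) \<longlonglongrightarrow> c *\<^sub>R x"
      by (simp_all add: subspace_mul[OF assms] tendsto_scaleR)
    then show ?thesis unfolding closure_sequential by (intro exI conjI)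
  qed
qed

text \<open>The projection of \<open>w\<close> onto \<open>closure V\<close> differs from
  \<open>w\<close> by an element of \<open>W\<close> orthogonal to \<open>V\<close>. Applied to
  graphs, this is the criterion for a core.\<close>

lemma subset_closure_of_orthogonal_trivial:
  fixes V :: "'b::{real_inner, complete_space} set"
  assumes V: "subspace V" and W: "subspace W" "closed W" and "V \<subseteq> W"
    and triv: "\<And>w. w \<in> W \<Longrightarrow> (\<And>v. v \<in> V \<Longrightarrow> inner w v = 0) \<Longrightarrow> w = 0"
  shows "W \<subseteq> closure V"
proof
  fix w assume w: "w \<in> W"
  obtain p where p: "p \<in> closure V" "\<And>v. v \<in> closure V \<Longrightarrow> inner (w - p) v = 0"
    using orthogonal_projection_exists[OF subspace_closure[OF V] closed_closure] by blast
  have "closure V \<subseteq> W" using W(2) \<open>V \<subseteq> W\<close> by (rule closure_minimal[rotated])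
  then have "w - p \<in> W" using p(1) w W(1) by (auto intro: subspace_diff)
  then have "w - p = 0" using p(2) closure_subset by (intro triv) auto
  then show "w \<in> closure V" using p(1) by simp
qed

section \<open>The absolute value of a self-adjoint contraction\<close>

text \<open>The iteration \<open>Y \<mapsto> (X + Y\<^sup>2) / 2\<close> is dominated in norm by the same iteration on numbers
  started with \<open>X = 1\<close>, whose limit is \<open>1\<close>. Its fixed point satisfies \<open>(1 - Y)\<^sup>2 = 1 - X\<close>.\<close>

fun sqrt_iter :: "('a::real_normed_vector \<Rightarrow>\<^sub>L 'a) \<Rightarrow> nat \<Rightarrow> 'a \<Rightarrow>\<^sub>L 'a" where
  "sqrt_iter X 0 = 0"
| "sqrt_iter X (Suc n) = (1 / 2) *\<^sub>R (X + (sqrt_iter X n o\<^sub>L sqrt_iter X n))"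

fun sqrt_bound :: "nat \<Rightarrow> real" where
  "sqrt_bound 0 = 0"
| "sqrt_bound (Suc n) = (1 + (sqrt_bound n)\<^sup>2) / 2"

lemma sqrt_bound_range: "0 \<le> sqrt_bound n \<and> sqrt_bound n \<le> 1"
  by (induction n) (auto simp: power_le_one)

lemma sqrt_bound_le_Suc: "sqrt_bound n \<le> sqrt_bound (Suc n)"
proof -
  have "0 \<le> (1 - sqrt_bound n)\<^sup>2" by simp
  then show ?thesis by (simp add: power2_eq_square algebra_simps)
qed

lemma norm_sqrt_iter: "norm X \<le> 1 \<Longrightarrow> norm (sqrt_iter X n) \<le> sqrt_bound n"
proof (induction n)
  case (Suc n)
  have "norm (sqrt_iter X n o\<^sub>L sqrt_iter X n) \<le> norm (sqrt_iter X n) * norm (sqrt_iter X n)"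
    by (rule norm_blinfun_compose)
  also have "\<dots> \<le> (sqrt_bound n)\<^sup>2"
    unfolding power2_eq_square using Suc sqrt_bound_range by (intro mult_mono) auto
  finally show ?case
    using norm_triangle_ineq[of X "sqrt_iter X n o\<^sub>L sqrt_iter X n"] Suc.prems by simp
qed simp

text \<open>The splitting \<open>Y\<^sup>2 - Z\<^sup>2 = Y (Y - Z) + (Y - Z) Z\<close> is valid for
  operators as well as for numbers, so the numerical increments dominate.\<close>

lemma norm_sqrt_iter_diff:
  assumes X: "norm X \<le> 1"
  shows "norm (sqrt_iter X (Suc n) - sqrt_iter X n) \<le> sqrt_bound (Suc n) - sqrt_bound n"
proof (induction n)
  case (Suc n)
  define Y Z y z where YZ: "Y = sqrt_iter X (Suc n)" "Z = sqrt_iter X n"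
    "y = sqrt_bound (Suc n)" "z = sqrt_bound n"
  have nY: "norm Y \<le> y" and nZ: "norm Z \<le> z" and nd: "norm (Y - Z) \<le> y - z"
    using norm_sqrt_iter[OF X] Suc unfolding YZ by blast+
  have pos: "0 \<le> y" "0 \<le> z" "0 \<le> y - z"
    using sqrt_bound_range sqrt_bound_le_Suc[of n] unfolding YZ by auto
  have "sqrt_iter X (Suc (Suc n)) - sqrt_iter X (Suc n) = (1 / 2) *\<^sub>R ((Y o\<^sub>L Y) - (Z o\<^sub>L Z))"
    using sqrt_iter.simps(2)[of X "Suc n"] sqrt_iter.simps(2)[of X n]
    unfolding YZ[symmetric] by (simp del: sqrt_iter.simps sqrt_bound.simps add: scaleR_diff_right[symmetric])
  also have "(Y o\<^sub>L Y) - (Z o\<^sub>L Z) = (Y o\<^sub>L (Y - Z)) + ((Y - Z) o\<^sub>L Z)"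
    by (simp add: bounded_bilinear.diff_left[OF bounded_bilinear_blinfun_compose]
        bounded_bilinear.diff_right[OF bounded_bilinear_blinfun_compose])
  finally have "norm (sqrt_iter X (Suc (Suc n)) - sqrt_iter X (Suc n))
      \<le> (norm (Y o\<^sub>L (Y - Z)) + norm ((Y - Z) o\<^sub>L Z)) / 2"
    using norm_triangle_ineq[of "Y o\<^sub>L (Y - Z)" "(Y - Z) o\<^sub>L Z"] by simp
  also have "\<dots> \<le> (y * (y - z) + (y - z) * z) / 2"
    by (intro divide_right_mono add_mono order_trans[OF norm_blinfun_compose] mult_mono)
      (use nY nZ nd pos in auto)
  also have "\<dots> = (1 + y\<^sup>2) / 2 - (1 + z\<^sup>2) / 2"
    by (simp add: power2_eq_square field_simps)
  also have "\<dots> = sqrt_bound (Suc (Suc n)) - sqrt_bound (Suc n)"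
    by (simp add: YZ)
  finally show ?case .
qed (use X in simp)

text \<open>The increments are summable by comparison with the telescoping series of the monotone
  bounded sequence \<open>sqrt_bound\<close>; the recursion then passes to the limit.\<close>

lemma sqrt_iter_fixpoint:
  fixes X :: "'a::banach \<Rightarrow>\<^sub>L 'a"
  assumes X: "norm X \<le> 1"
  obtains Y where "sqrt_iter X \<longlonglongrightarrow> Y" "norm Y \<le> 1" "2 *\<^sub>R Y = X + (Y o\<^sub>L Y)"
proof -
  have "convergent sqrt_bound"
    using sqrt_bound_range sqrt_bound_le_Suc
    by (intro Bseq_monoseq_convergent BseqI'[where K = 1] mono_SucI1 incseq_imp_monoseq) (auto simp: incseq_Suc_iff)
  then have "convergent (\<lambda>n. sqrt_bound n - sqrt_bound 0)"
    by (intro convergent_diff convergent_const)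
  then have "summable (\<lambda>n. sqrt_bound (Suc n) - sqrt_bound n)"
    unfolding summable_iff_convergent sum_lessThan_telescope .
  then have "summable (\<lambda>n. sqrt_iter X (Suc n) - sqrt_iter X n)"
    by (rule summable_comparison_test'[where N = 0]) (rule norm_sqrt_iter_diff[OF X])
  then have "convergent (\<lambda>n. sqrt_iter X n - sqrt_iter X 0)"
    unfolding summable_iff_convergent sum_lessThan_telescope .
  then obtain Y where Y: "sqrt_iter X \<longlonglongrightarrow> Y" by (auto simp: convergent_def)
  have "norm (sqrt_iter X n) \<le> 1" for n
    using norm_sqrt_iter[OF X, of n] sqrt_bound_range[of n] by linarith
  then have "norm Y \<le> 1"
    using Y by (intro LIMSEQ_le_const2[OF tendsto_norm[OF Y]]) auto
  moreover have "2 *\<^sub>R Y = X + (Y o\<^sub>L Y)"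
  proof -
    have "(\<lambda>n. 2 *\<^sub>R sqrt_iter X (Suc n)) \<longlonglongrightarrow> 2 *\<^sub>R Y"
      by (intro tendsto_intros LIMSEQ_Suc[OF Y])
    moreover have "(\<lambda>n. X + (sqrt_iter X n o\<^sub>L sqrt_iter X n)) \<longlonglongrightarrow> X + (Y o\<^sub>L Y)"
      by (intro tendsto_intros Y bounded_bilinear.tendsto[OF bounded_bilinear_blinfun_compose])
    moreover have "2 *\<^sub>R sqrt_iter X (Suc n) = X + (sqrt_iter X n o\<^sub>L sqrt_iter X n)" for n
      by simp
    ultimately show ?thesis by (simp only: LIMSEQ_unique)
  qed
  ultimately show ?thesis using Y that by blast
qed

lemma blinfun_compose_assoc: "(F o\<^sub>L G) o\<^sub>L K = F o\<^sub>L (G o\<^sub>L K)"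
  by (rule blinfun_eqI) simp

text \<open>The iterates are polynomials in \<open>X\<close>. In the limit, the absolute value
  commutes with everything that commutes with \<open>S\<close>.\<close>

lemma sqrt_iter_commute:
  "C o\<^sub>L X = X o\<^sub>L C \<Longrightarrow> C o\<^sub>L sqrt_iter X n = sqrt_iter X n o\<^sub>L C"
proof (induction n)
  case (Suc n)
  have "C o\<^sub>L (sqrt_iter X n o\<^sub>L sqrt_iter X n) = (sqrt_iter X n o\<^sub>L sqrt_iter X n) o\<^sub>L C"
  proof -
    have "C o\<^sub>L (sqrt_iter X n o\<^sub>L sqrt_iter X n) = (C o\<^sub>L sqrt_iter X n) o\<^sub>L sqrt_iter X n"
      by (simp add: blinfun_compose_assoc)
    also have "\<dots> = sqrt_iter X n o\<^sub>L (C o\<^sub>L sqrt_iter X n)"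
      using Suc by (simp add: blinfun_compose_assoc)
    also have "\<dots> = (sqrt_iter X n o\<^sub>L sqrt_iter X n) o\<^sub>L C"
      using Suc by (simp add: blinfun_compose_assoc)
    finally show ?thesis .
  qed
  then show ?case
    using Suc.prems
    by (simp add: bounded_bilinear.add_left[OF bounded_bilinear_blinfun_compose]
        bounded_bilinear.add_right[OF bounded_bilinear_blinfun_compose]
        bounded_bilinear.scaleR_left[OF bounded_bilinear_blinfun_compose]
        bounded_bilinear.scaleR_right[OF bounded_bilinear_blinfun_compose])
qed simp

lemma sqrt_iter_symmetric:
  assumes "\<And>x y. inner (blinfun_apply X x) y = inner x (blinfun_apply X y)"
  shows "inner (blinfun_apply (sqrt_iter X n) x) y = inner x (blinfun_apply (sqrt_iter X n) y)"
  by (induction n arbitrary: x y)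
    (simp_all add: assms blinfun.add_left blinfun.scaleR_left inner_add_left inner_add_right)

text \<open>\<open>R\<close> is the absolute value of \<open>S\<close>, namely
  \<open>id_blinfun - Y\<close> for the fixed point \<open>Y\<close> belonging to
  \<open>X = id_blinfun - (S o\<^sub>L S)\<close>. The bound on \<open>id_blinfun - R\<close>
  encodes positivity of \<open>R\<close> and later yields a contraction.\<close>

lemma absolute_value_exists:
  fixes S :: "'a::{real_inner, banach} \<Rightarrow>\<^sub>L 'a"
  assumes sym: "\<And>x y. inner (blinfun_apply S x) y = inner x (blinfun_apply S y)"
    and S: "norm S \<le> 1"
  obtains R where "\<And>x. blinfun_apply R (blinfun_apply R x) = blinfun_apply S (blinfun_apply S x)"
    "norm (id_blinfun - R) \<le> 1"
    "\<And>x y. inner (blinfun_apply R x) y = inner x (blinfun_apply R y)"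
    "\<And>C. C o\<^sub>L S = S o\<^sub>L C \<Longrightarrow> C o\<^sub>L R = R o\<^sub>L C"
proof -
  define X where "X = id_blinfun - (S o\<^sub>L S)"
  have X_apply: "blinfun_apply X x = x - blinfun_apply S (blinfun_apply S x)" for x
    by (simp add: X_def blinfun.diff_left)
  have X_sym: "inner (blinfun_apply X x) y = inner x (blinfun_apply X y)" for x y
    by (simp add: X_apply inner_diff_left inner_diff_right sym)
  have "norm X \<le> 1"
  proof (rule norm_blinfun_bound)
    fix x
    have "(norm (blinfun_apply X x))\<^sup>2
        = (norm x)\<^sup>2 - 2 * (norm (blinfun_apply S x))\<^sup>2 + (norm (blinfun_apply S (blinfun_apply S x)))\<^sup>2"
      unfolding X_apply power2_norm_eq_inner
      by (simp add: inner_diff_left inner_diff_right sym inner_commute)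
    also have "norm (blinfun_apply S (blinfun_apply S x)) \<le> norm (blinfun_apply S x)"
      using norm_blinfun[of S "blinfun_apply S x"] mult_right_mono[OF S norm_ge_zero, of "blinfun_apply S x"]
      by simp
    then have "(norm (blinfun_apply S (blinfun_apply S x)))\<^sup>2 \<le> (norm (blinfun_apply S x))\<^sup>2"
      by (simp add: power_mono)
    then have "(norm x)\<^sup>2 - 2 * (norm (blinfun_apply S x))\<^sup>2 + (norm (blinfun_apply S (blinfun_apply S x)))\<^sup>2
        \<le> (norm x)\<^sup>2"
      using zero_le_power2[of "norm (blinfun_apply S x)"] by linarith
    finally show "norm (blinfun_apply X x) \<le> 1 * norm x" by simp
  qed simp
  then obtain Y where Y: "sqrt_iter X \<longlonglongrightarrow> Y" "norm Y \<le> 1" "2 *\<^sub>R Y = X + (Y o\<^sub>L Y)"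
    by (rule sqrt_iter_fixpoint)
  define R where "R = id_blinfun - Y"
  have R_apply: "blinfun_apply R x = x - blinfun_apply Y x" for x
    by (simp add: R_def blinfun.diff_left)
  show ?thesis
  proof
    fix x
    have "blinfun_apply (2 *\<^sub>R Y) x = blinfun_apply (X + (Y o\<^sub>L Y)) x" by (simp only: Y(3))
    then show "blinfun_apply R (blinfun_apply R x) = blinfun_apply S (blinfun_apply S x)"
      by (simp add: R_apply X_apply blinfun.diff_right blinfun.add_left blinfun.scaleR_left
          scaleR_2 algebra_simps)
  next
    show "norm (id_blinfun - R) \<le> 1" using Y(2) by (simp add: R_def)
  next
    fix x y
    have "(\<lambda>n. inner (blinfun_apply (sqrt_iter X n) x) y) \<longlonglongrightarrow> inner (blinfun_apply Y x) y"
      by (intro tendsto_intros Y(1))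
    moreover have "(\<lambda>n. inner x (blinfun_apply (sqrt_iter X n) y)) \<longlonglongrightarrow> inner x (blinfun_apply Y y)"
      by (intro tendsto_intros Y(1))
    ultimately have "inner (blinfun_apply Y x) y = inner x (blinfun_apply Y y)"
      by (simp add: sqrt_iter_symmetric[OF X_sym] LIMSEQ_unique)
    then show "inner (blinfun_apply R x) y = inner x (blinfun_apply R y)"
      by (simp add: R_apply inner_diff_left inner_diff_right)
  next
    fix C assume C: "C o\<^sub>L S = S o\<^sub>L C"
    have CS: "blinfun_apply C (blinfun_apply S x) = blinfun_apply S (blinfun_apply C x)" for x
      using arg_cong[OF C, of "\<lambda>F. blinfun_apply F x"] by simp
    have "C o\<^sub>L X = X o\<^sub>L C"
      by (rule blinfun_eqI) (simp add: X_apply CS blinfun.diff_right)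
    then have comm: "C o\<^sub>L sqrt_iter X n = sqrt_iter X n o\<^sub>L C" for n
      by (rule sqrt_iter_commute)
    have "(\<lambda>n. C o\<^sub>L sqrt_iter X n) \<longlonglongrightarrow> (C o\<^sub>L Y)"
      by (intro bounded_bilinear.tendsto[OF bounded_bilinear_blinfun_compose] tendsto_const Y(1))
    moreover have "(\<lambda>n. sqrt_iter X n o\<^sub>L C) \<longlonglongrightarrow> (Y o\<^sub>L C)"
      by (intro bounded_bilinear.tendsto[OF bounded_bilinear_blinfun_compose] tendsto_const Y(1))
    ultimately have "C o\<^sub>L Y = Y o\<^sub>L C" by (simp add: comm LIMSEQ_unique)
    then have "blinfun_apply C (blinfun_apply Y x) = blinfun_apply Y (blinfun_apply C x)" for x
      by (metis blinfun_apply_blinfun_compose)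
    then show "C o\<^sub>L R = R o\<^sub>L C"
      by (intro blinfun_eqI) (simp add: R_apply blinfun.diff_right)
  qed
qed

section \<open>Spectral localization of normal operators\<close>

text \<open>A closed operator as a total function \<open>t\<close> together with its domain
  \<open>D\<close>; only the values on \<open>D\<close> matter. This avoids unwrapping options in
  terms such as \<open>t (G u)\<close>.\<close>

locale closed_linear =
  fixes D :: "'a::chilbert_space set" and t :: "'a \<Rightarrow> 'a"
  assumes zero_mem: "0 \<in> D"
    and add_mem: "x \<in> D \<Longrightarrow> y \<in> D \<Longrightarrow> x + y \<in> D"
    and t_add: "x \<in> D \<Longrightarrow> y \<in> D \<Longrightarrow> t (x + y) = t x + t y"
    and scale_mem: "x \<in> D \<Longrightarrow> c *\<^sub>C x \<in> D"
    and t_scale: "x \<in> D \<Longrightarrow> t (c *\<^sub>C x) = c *\<^sub>C t x"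
    and closed_graph: "closed ((\<lambda>x. (x, t x)) ` D)"
begin

lemma diff_mem: "x \<in> D \<Longrightarrow> y \<in> D \<Longrightarrow> x - y \<in> D"
  using add_mem[OF _ scale_mem[of y "-1"]] by (simp add: scaleC_minus_one)

lemma t_diff: "x \<in> D \<Longrightarrow> y \<in> D \<Longrightarrow> t (x - y) = t x - t y"
  using t_add[OF _ scale_mem[of y "-1"], of x] t_scale[of y "-1"] by (simp add: scaleC_minus_one)

lemma t_zero: "t 0 = 0"
  using t_diff[OF zero_mem zero_mem] by simp

lemma subspace_graph_on:
  assumes E: "E \<subseteq> D" "0 \<in> E" "\<And>x y. x \<in> E \<Longrightarrow> y \<in> E \<Longrightarrow> x + y \<in> E"
    "\<And>c x. x \<in> E \<Longrightarrow> c *\<^sub>C x \<in> E"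
  shows "subspace ((\<lambda>x. (x, t x)) ` E)"
proof (rule subspaceI)
  show "0 \<in> (\<lambda>x. (x, t x)) ` E" using E(2) t_zero by (auto simp: zero_prod_def image_iff)
  show "x + y \<in> (\<lambda>x. (x, t x)) ` E" if "x \<in> (\<lambda>x. (x, t x)) ` E" "y \<in> (\<lambda>x. (x, t x)) ` E" for x y
    using that E(1,3) t_add by (auto simp: image_iff subset_iff)
  show "c *\<^sub>R x \<in> (\<lambda>x. (x, t x)) ` E" if "x \<in> (\<lambda>x. (x, t x)) ` E" for c x
    using that E(1,4) t_scale by (auto simp: image_iff scaleR_eq_scaleC subset_iff)
qed

lemma subspace_graph: "subspace ((\<lambda>x. (x, t x)) ` D)"
  by (rule subspace_graph_on) (auto intro: zero_mem add_mem scale_mem)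

text \<open>The resolvent \<open>(1 + t\<^sup>* t)\<^sup>-\<^sup>1\<close>, obtained by projecting \<open>(u, 0)\<close> onto the graph.\<close>

definition is_resolvent :: "'a \<Rightarrow> 'a \<Rightarrow> bool" where
  "is_resolvent u x \<longleftrightarrow> x \<in> D \<and> (\<forall>w\<in>D. cinner (u - x) w = cinner (t x) (t w))"

lemma is_resolvent_exists: "\<exists>x. is_resolvent u x"
proof -
  obtain x where x: "x \<in> D" "\<And>w. w \<in> D \<Longrightarrow> inner ((u, 0) - (x, t x)) (w, t w) = 0"
    using orthogonal_projection_exists[OF subspace_graph closed_graph, of "(u, 0)"] by auto
  then have "inner (u - x) w = inner (t x) (t w)" if "w \<in> D" for w
    using x(2)[OF that] by (simp add: inner_diff_left inner_diff_right)
  \<comment> \<open>The real identity at \<open>w\<close> gives the real part, and at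
    \<open>\<i> *\<^sub>C w\<close> the imaginary part.\<close>
  then have "cinner (u - x) w = cinner (t x) (t w)" if "w \<in> D" for w
    using that scale_mem[OF that, of \<i>] t_scale[OF that, of \<i>] by (simp add: cinner_eq_Complex)
  then show ?thesis using x(1) unfolding is_resolvent_def by blast
qed

text \<open>Subtracting the two equations and testing with \<open>x - y\<close> equates minus the
  squared norm of \<open>x - y\<close> with the squared norm of \<open>t (x - y)\<close>.\<close>

lemma is_resolvent_unique:
  assumes "is_resolvent u x" "is_resolvent u y"
  shows "x = y"
proof -
  have D: "x \<in> D" "y \<in> D" using assms by (auto simp: is_resolvent_def)
  note xy = diff_mem[OF D]
  have "cinner (u - x) (x - y) = cinner (t x) (t (x - y))"
    "cinner (u - y) (x - y) = cinner (t y) (t (x - y))"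
    using assms xy by (auto simp: is_resolvent_def)
  then have "cinner (u - x - (u - y)) (x - y) = cinner (t x - t y) (t (x - y))"
    by (simp only: cinner_diff_left)
  then have "cinner (- (x - y)) (x - y) = cinner (t (x - y)) (t (x - y))"
    by (simp add: t_diff[OF D])
  then have "- inner (x - y) (x - y) = inner (t (x - y)) (t (x - y))"
    unfolding cinner_minus_left inner_eq_Re_cinner by (metis uminus_complex.sel(1))
  then have "inner (x - y) (x - y) = 0"
    using inner_ge_zero[of "t (x - y)"] inner_ge_zero[of "x - y"] by linarith
  then show ?thesis by simp
qed

definition G :: "'a \<Rightarrow> 'a" where "G u = (THE x. is_resolvent u x)"

lemma is_resolvent_G: "is_resolvent u (G u)"
  unfolding G_def using is_resolvent_exists is_resolvent_unique by (metis theI)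

lemma G_eqI: "is_resolvent u x \<Longrightarrow> G u = x"
  using is_resolvent_G is_resolvent_unique by blast

lemma G_mem: "G u \<in> D"
  using is_resolvent_G by (simp add: is_resolvent_def)

lemma G_cinner: "w \<in> D \<Longrightarrow> cinner (u - G u) w = cinner (t (G u)) (t w)"
  using is_resolvent_G by (simp add: is_resolvent_def)

lemma G_inner: "w \<in> D \<Longrightarrow> inner (u - G u) w = inner (t (G u)) (t w)"
  by (simp add: inner_eq_Re_cinner G_cinner)

lemma G_add: "G (u + v) = G u + G v"
proof (rule G_eqI)
  have "u + v - (G u + G v) = (u - G u) + (v - G v)" by simp
  then show "is_resolvent (u + v) (G u + G v)"
    unfolding is_resolvent_def by (simp only: add_mem G_mem t_add cinner_add_left) (simp add: G_cinner)
qed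

lemma G_scale: "G (c *\<^sub>C u) = c *\<^sub>C G u"
proof (rule G_eqI)
  show "is_resolvent (c *\<^sub>C u) (c *\<^sub>C G u)"
    unfolding is_resolvent_def scaleC_diff_right[symmetric]
    by (simp add: scale_mem G_mem t_scale cinner_scaleC_left G_cinner)
qed

text \<open>The defining equation of \<open>G u\<close> tested with \<open>G u\<close> itself. All
  norm estimates for \<open>G\<close> and \<open>t G\<close> come from this energy identity.\<close>

lemma inner_G_self: "inner u (G u) = (norm (G u))\<^sup>2 + (norm (t (G u)))\<^sup>2"
  using G_inner[OF G_mem, of u u] by (simp add: inner_diff_left power2_norm_eq_inner)

lemma inner_G_commute: "inner (G u) v = inner u (G v)"
proof -
  have "inner u (G v) = inner (G u) (G v) + inner (t (G u)) (t (G v))"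
    using G_inner[OF G_mem, of u v] by (simp add: inner_diff_left)
  moreover have "inner v (G u) = inner (G v) (G u) + inner (t (G v)) (t (G u))"
    using G_inner[OF G_mem, of v u] by (simp add: inner_diff_left)
  ultimately show ?thesis by (simp add: inner_commute)
qed

lemma norm_G_le: "norm (G u) \<le> norm u"
  and norm_t_G_le: "norm (t (G u)) \<le> norm u"
proof -
  have "inner u (G u) \<le> norm u * norm (G u)" by (rule norm_cauchy_schwarz)
  also have "\<dots> \<le> ((norm u)\<^sup>2 + (norm (G u))\<^sup>2) / 2"
    using zero_le_power2[of "norm u - norm (G u)"] by (simp add: power2_eq_square algebra_simps)
  finally have *: "(norm (G u))\<^sup>2 + 2 * (norm (t (G u)))\<^sup>2 \<le> (norm u)\<^sup>2"
    using inner_G_self[of u] by (simp add: field_simps)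
  have "(norm (G u))\<^sup>2 \<le> (norm u)\<^sup>2" "(norm (t (G u)))\<^sup>2 \<le> (norm u)\<^sup>2"
    using * zero_le_power2[of "norm (G u)"] zero_le_power2[of "norm (t (G u))"] by linarith+
  then show "norm (G u) \<le> norm u" "norm (t (G u)) \<le> norm u"
    by simp_all
qed

lemma bounded_linear_G: "bounded_linear G"
  by (rule bounded_linear_intro[where K = 1])
    (simp_all add: G_add G_scale scaleR_eq_scaleC norm_G_le)

lemma bounded_linear_t_G: "bounded_linear (\<lambda>u. t (G u))"
  by (rule bounded_linear_intro[where K = 1])
    (simp_all add: G_add G_scale G_mem t_add t_scale scaleR_eq_scaleC norm_t_G_le)

end

text \<open>\<open>adjoint_iff\<close> makes \<open>t'\<close> the full adjoint of \<open>t\<close>,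
  with the same domain \<open>D\<close>; given this, the last two assumptions express that the two
  products agree, including their domains.\<close>

locale normal_pair = closed_linear +
  fixes t' :: "'a \<Rightarrow> 'a"
  assumes adjoint_iff: "(\<forall>x\<in>D. cinner (t x) y = cinner x z) \<longleftrightarrow> y \<in> D \<and> t' y = z"
    and comm_dom: "x \<in> D \<Longrightarrow> t x \<in> D \<longleftrightarrow> t' x \<in> D"
    and comm: "x \<in> D \<Longrightarrow> t x \<in> D \<Longrightarrow> t (t' x) = t' (t x)"
begin

text \<open>The weak equation for \<open>G u\<close>, read through \<open>adjoint_iff\<close>,
  becomes the strong equation \<open>G u + t' (t (G u)) = u\<close>.\<close>

lemma t_G_mem: "t (G u) \<in> D" and adj_t_G: "t' (t (G u)) = u - G u"
proof -
  have "\<forall>w\<in>D. cinner (t w) (t (G u)) = cinner w (u - G u)"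
    using G_cinner[of _ u] by (metis cinner_commute)
  then show "t (G u) \<in> D" "t' (t (G u)) = u - G u"
    using adjoint_iff by blast+
qed

text \<open>Applying \<open>t\<close> to \<open>t' (t x) = u - x\<close> and exchanging
  \<open>t\<close> with \<open>t'\<close> shows that \<open>t x\<close> solves the resolvent
  equation for \<open>t u\<close>.\<close>

lemma t_G_commute:
  assumes u: "u \<in> D"
  shows "t (G u) = G (t u)"
proof -
  define x where "x = G u"
  have x: "x \<in> D" "t x \<in> D" and adj: "t' (t x) = u - x"
    using G_mem t_G_mem adj_t_G by (simp_all add: x_def)
  have ux: "u - x \<in> D" using diff_mem[OF u x(1)] .
  have ttx: "t (t x) \<in> D" using comm_dom[OF x(2)] adj ux by simp
  have "t (t' (t x)) = t' (t (t x))" by (rule comm[OF x(2) ttx])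
  then have "t' (t (t x)) = t u - t x" using adj t_diff[OF u x(1)] by simp
  then have "\<forall>w\<in>D. cinner (t w) (t (t x)) = cinner w (t u - t x)"
    using adjoint_iff ttx by blast
  then have "is_resolvent (t u) (t x)"
    using x(2) unfolding is_resolvent_def by (metis cinner_commute)
  then show ?thesis unfolding x_def by (rule G_eqI[symmetric])
qed

text \<open>\<open>L\<close> is the spectral subspace of \<open>(1 + t\<^sup>* t)\<^sup>-\<^sup>1\<close> for \<open>[1/2, 1]\<close>, described as the kernel of
  \<open>\<bar>S\<bar> - S\<close> where \<open>S = 2 (1 + t\<^sup>* t)\<^sup>-\<^sup>1 - 1\<close>.\<close>

lemma spectral_localization:
  assumes "x0 \<in> D" "norm (t x0) < norm x0"
  shows "\<exists>L. L \<subseteq> D \<and> (\<exists>x\<in>L. x \<noteq> 0) \<and> (\<forall>x\<in>L. \<forall>y\<in>L. x + y \<in> L)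
    \<and> (\<forall>c. \<forall>x\<in>L. c *\<^sub>C x \<in> L) \<and> (\<forall>x\<in>L. t x \<in> L \<and> norm (t x) \<le> norm x)"
proof -
  define S where "S = Blinfun (\<lambda>u. 2 *\<^sub>R G u - u)"
  have S: "blinfun_apply S u = 2 *\<^sub>R G u - u" for u
    unfolding S_def
    by (subst bounded_linear_Blinfun_apply)
      (auto intro!: bounded_linear_sub bounded_linear_ident bounded_linear_G
        bounded_linear_compose[OF bounded_linear_scaleR_right])
  have S_sym: "inner (blinfun_apply S x) y = inner x (blinfun_apply S y)" for x y
    by (simp add: S inner_diff_left inner_diff_right inner_G_commute)
  have "norm S \<le> 1"
  proof (rule norm_blinfun_bound)
    fix u
    have "(norm (blinfun_apply S u))\<^sup>2 = 4 * (norm (G u))\<^sup>2 - 4 * inner u (G u) + (norm u)\<^sup>2"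
      by (simp add: S power2_norm_eq_inner inner_diff_left inner_diff_right inner_commute)
    also have "\<dots> \<le> (norm u)\<^sup>2" by (simp add: inner_G_self)
    finally show "norm (blinfun_apply S u) \<le> 1 * norm u" by simp
  qed simp
  then obtain R where R: "\<And>x. blinfun_apply R (blinfun_apply R x) = blinfun_apply S (blinfun_apply S x)"
    "norm (id_blinfun - R) \<le> 1"
    "\<And>x y. inner (blinfun_apply R x) y = inner x (blinfun_apply R y)"
    "\<And>C. C o\<^sub>L S = S o\<^sub>L C \<Longrightarrow> C o\<^sub>L R = R o\<^sub>L C"
    using absolute_value_exists[OF S_sym] by blast
  \<comment> \<open>Commutation with \<open>G\<close> passes to \<open>S\<close> and then to
    \<open>R\<close>. It is used for complex scalars, making \<open>R\<close> complex linear, and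
    for \<open>t G\<close>, making \<open>L\<close> invariant under \<open>t\<close>.\<close>
  have R_comm: "c (blinfun_apply R x) = blinfun_apply R (c x)"
    if c: "bounded_linear c" and "\<And>u. c (G u) = G (c u)" for c x
  proof -
    interpret c: bounded_linear c by fact
    have "Blinfun c o\<^sub>L S = S o\<^sub>L Blinfun c"
      by (rule blinfun_eqI) (simp add: bounded_linear_Blinfun_apply[OF c] S that(2) c.diff c.scaleR)
    from R(4)[OF this] show ?thesis
      by (metis blinfun_apply_blinfun_compose bounded_linear_Blinfun_apply[OF c])
  qed
  have RS: "blinfun_apply R (blinfun_apply S x) = blinfun_apply S (blinfun_apply R x)" for x
    using R(4)[of S] by (metis blinfun_apply_blinfun_compose)
  have nY: "norm (x - blinfun_apply R x) \<le> norm x" for x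
  proof -
    have "norm (blinfun_apply (id_blinfun - R) x) \<le> norm (id_blinfun - R) * norm x"
      by (rule norm_blinfun)
    also have "\<dots> \<le> 1 * norm x" by (rule mult_right_mono[OF R(2) norm_ge_zero])
    finally show ?thesis by (simp add: blinfun.diff_left)
  qed
  have R_pos: "0 \<le> inner (blinfun_apply R x) x" for x
  proof -
    have "inner (x - blinfun_apply R x) x \<le> norm (x - blinfun_apply R x) * norm x"
      by (rule norm_cauchy_schwarz)
    also have "\<dots> \<le> norm x * norm x" by (rule mult_right_mono[OF nY norm_ge_zero])
    finally show ?thesis
      by (simp add: inner_diff_left power2_norm_eq_inner flip: power2_eq_square)
  qed
  define L where "L = {x. blinfun_apply R x = blinfun_apply S x}"
  have L_add: "x + y \<in> L" if "x \<in> L" "y \<in> L" for x y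
    using that by (simp add: L_def blinfun.add_right)
  have S_scale: "blinfun_apply S (c *\<^sub>C x) = c *\<^sub>C blinfun_apply S x" for c x
    by (simp add: S G_scale scaleC_diff_right scaleR_eq_scaleC scaleC_scaleC mult.commute)
  have L_scale: "c *\<^sub>C x \<in> L" if "x \<in> L" for c x
    using that R_comm[OF bounded_linear_scaleC G_scale[symmetric], of c x]
    by (simp add: L_def S_scale)
  have L_scaleR: "c *\<^sub>R x \<in> L" if "x \<in> L" for c x
    using L_scale[OF that] by (simp add: scaleR_eq_scaleC)
  have G_L: "2 *\<^sub>R G y = blinfun_apply R y + y" if "y \<in> L" for y
    using that S[of y] by (simp add: L_def)
  have "closed L"
    unfolding L_def by (intro closed_Collect_eq continuous_intros)
  \<comment> \<open>On \<open>L\<close> the operator \<open>2 G\<close> equals \<open>R + 1\<close>,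
    so \<open>G y = x\<close> reads \<open>y = x + (y - R y) / 2\<close>. The right side is a
    contraction of the complete set \<open>L\<close> with constant \<open>1/2\<close>, because
    \<open>1 - R\<close> has norm at most \<open>1\<close>.\<close>
  have ex_preimage: "\<exists>y\<in>L. G y = x" if x: "x \<in> L" for x
  proof -
    define f where "f y = x + (1 / 2) *\<^sub>R (y - blinfun_apply R y)" for y
    have "\<exists>!y\<in>L. f y = y"
    proof (rule Banach_fix[where c = "1/2"])
      show "complete L" using \<open>closed L\<close> by (simp add: complete_eq_closed)
      show "L \<noteq> {}" using x by blast
      show "f ` L \<subseteq> L"
      proof clarify
        fix y assume y: "y \<in> L"
        then have "blinfun_apply R y \<in> L" by (simp add: L_def RS)
        then have "y - blinfun_apply R y \<in> L" using y L_add[OF y L_scaleR, of _ "-1"] by simp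
        then show "f y \<in> L" unfolding f_def by (intro L_add x L_scaleR)
      qed
      show "dist (f y) (f z) \<le> 1 / 2 * dist y z" if "y \<in> L" "z \<in> L" for y z
      proof -
        have "f y - f z = (1 / 2) *\<^sub>R ((y - z) - blinfun_apply R (y - z))"
          by (simp add: f_def blinfun.diff_right algebra_simps)
        then show ?thesis using nY[of "y - z"] by (simp add: dist_norm)
      qed
    qed auto
    then obtain y where y: "y \<in> L" "f y = y" by blast
    have "2 *\<^sub>R y = 2 *\<^sub>R f y" by (simp add: y(2))
    also have "\<dots> = 2 *\<^sub>R x + (y - blinfun_apply R y)" by (simp add: f_def scaleR_add_right)
    finally have "2 *\<^sub>R x = blinfun_apply R y + y" by (simp add: scaleR_2 algebra_simps)
    then have "2 *\<^sub>R x = 2 *\<^sub>R G y" using G_L[OF y(1)] by simp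
    then show ?thesis using y(1) by auto
  qed
  have main: "x \<in> D \<and> t x \<in> L \<and> norm (t x) \<le> norm x" if x: "x \<in> L" for x
  proof -
    obtain y where y: "y \<in> L" "G y = x" using ex_preimage[OF x] by blast
    have xD: "x \<in> D" using G_mem y(2) by blast
    have comm: "t (G (G u)) = G (t (G u))" for u by (rule t_G_commute[OF G_mem])
    have tS: "t (G (blinfun_apply S u)) = blinfun_apply S (t (G u))" for u
    proof -
      interpret tG: bounded_linear "\<lambda>u. t (G u)" by (rule bounded_linear_t_G)
      show ?thesis by (simp add: S tG.diff tG.scaleR comm)
    qed
    have "t (G (blinfun_apply R y)) = blinfun_apply R (t (G y))"
      by (rule R_comm[OF bounded_linear_t_G comm])
    then have txL: "t x \<in> L" using y tS[of y] by (simp add: L_def)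
    \<comment> \<open>Positivity of \<open>R\<close> gives
      \<open>0 \<le> \<langle>R y, R y + y\<rangle>\<close>, where \<open>R y + y = 2 x\<close>.
      Since \<open>inner x y\<close> is the sum of the squared norms of \<open>x\<close> and
      \<open>t x\<close>, the bound on \<open>t x\<close> follows.\<close>
    have "2 * inner x y \<le> 4 * (norm x)\<^sup>2"
    proof -
      have "0 \<le> inner (blinfun_apply R y) (blinfun_apply R y + y)"
        using R_pos[of y] by (simp add: inner_add_right)
      also have "blinfun_apply R y + y = 2 *\<^sub>R x" using G_L[OF y(1)] y(2) by simp
      also have "blinfun_apply R y = 2 *\<^sub>R x - y" using G_L[OF y(1)] y(2) by (simp add: algebra_simps)
      finally show ?thesis
        by (simp add: inner_diff_left inner_diff_right power2_norm_eq_inner inner_commute)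
    qed
    then have "(norm (t x))\<^sup>2 \<le> (norm x)\<^sup>2"
      using inner_G_self[of y] y(2) by (simp add: inner_commute)
    then show ?thesis using xD txL by simp
  qed
  have "\<exists>x\<in>L. x \<noteq> 0"
  proof (rule ccontr)
    assume "\<not> (\<exists>x\<in>L. x \<noteq> 0)"
    then have L0: "x = 0" if "x \<in> L" for x using that by blast
    \<comment> \<open>Since \<open>R\<close> and \<open>S\<close> commute and have equal squares,
      \<open>R + S\<close> maps into \<open>L\<close>. If \<open>L\<close> were trivial,
      \<open>S\<close> would be \<open>- R\<close>, hence nonpositive.\<close>
    have RS0: "blinfun_apply R x + blinfun_apply S x = 0" for x
      by (rule L0) (simp add: L_def blinfun.add_right R(1) RS)
    define n g q where ngq: "n = (norm x0)\<^sup>2" "g = inner x0 (G x0)" "q = (norm (t x0))\<^sup>2"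
    have "blinfun_apply R x0 = - blinfun_apply S x0" using RS0[of x0] by (simp add: eq_neg_iff_add_eq_0)
    then have "0 \<le> inner (x0 - 2 *\<^sub>R G x0) x0" using R_pos[of x0] by (simp add: S)
    then have g_le: "2 * g \<le> n" by (simp add: ngq inner_diff_left inner_diff_right inner_commute power2_norm_eq_inner)
    have n0: "0 < n" "q < n" "0 \<le> q"
      using assms(2) norm_ge_zero[of "t x0"] power_strict_mono[OF assms(2), of 2]
      unfolding ngq by (auto simp del: zero_less_norm_iff intro: zero_less_power)
    \<comment> \<open>The equation for \<open>G x0\<close> tested with \<open>x0\<close>. Two uses
      of Cauchy-Schwarz, here and for \<open>g\<^sup>2 \<le> n * (norm (G x0))\<^sup>2\<close>, lead
      to \<open>n * (n - g) \<le> g * q\<close>, which is incompatible with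
      \<open>2 * g \<le> n\<close> and \<open>q < n\<close>.\<close>
    have "n - g = inner (t (G x0)) (t x0)"
      using G_inner[OF assms(1), of x0]
      by (simp add: ngq inner_diff_left inner_diff_right inner_commute power2_norm_eq_inner)
    then have "(n - g)\<^sup>2 \<le> (norm (t (G x0)))\<^sup>2 * q"
      using Cauchy_Schwarz_ineq[of "t (G x0)" "t x0"] by (simp add: ngq power2_norm_eq_inner)
    also have "(norm (t (G x0)))\<^sup>2 = g - (norm (G x0))\<^sup>2"
      using inner_G_self[of x0] by (simp add: ngq)
    finally have "n * (n - g)\<^sup>2 \<le> n * ((g - (norm (G x0))\<^sup>2) * q)"
      using n0 by (simp add: mult_left_mono)
    also have "\<dots> = (n * g - n * (norm (G x0))\<^sup>2) * q" by (simp add: algebra_simps)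
    also have "\<dots> \<le> (n * g - g\<^sup>2) * q"
      using Cauchy_Schwarz_ineq[of x0 "G x0"] n0
      by (intro mult_right_mono) (auto simp: ngq power2_norm_eq_inner)
    finally have "(n - g) * (n * (n - g)) \<le> (n - g) * (g * q)"
      by (simp add: power2_eq_square algebra_simps)
    then have 1: "n * (n - g) \<le> g * q" using g_le n0 by (simp add: mult_le_cancel_left)
    have "n * (n / 2) \<le> n * (n - g)" using g_le n0 by (intro mult_left_mono) auto
    also note 1
    also have "g * q \<le> n / 2 * q" using g_le n0 by (intro mult_right_mono) auto
    also have "\<dots> < n / 2 * n" using n0 by (intro mult_strict_left_mono) auto
    finally show False by simp
  qed
  then show ?thesis using main L_add L_scale by (intro exI[of _ L]) blast
qed

end

section \<open>Normal operators as pairs on a common domain\<close>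

lemma (in normal_pair) adjoint_pairing: "x \<in> D \<Longrightarrow> y \<in> D \<Longrightarrow> cinner (t x) y = cinner x (t' y)"
  using adjoint_iff by blast

lemma (in normal_pair) adj_diff:
  assumes "x \<in> D" "y \<in> D"
  shows "t' (x - y) = t' x - t' y"
proof -
  have "\<forall>w\<in>D. cinner (t w) (x - y) = cinner w (t' x - t' y)"
    using assms by (simp add: cinner_diff_right adjoint_pairing)
  then show ?thesis using adjoint_iff by blast
qed

lemma (in normal_pair) adj_scale:
  assumes "x \<in> D"
  shows "t' (c *\<^sub>C x) = c *\<^sub>C t' x"
proof -
  have "\<forall>w\<in>D. cinner (t w) (c *\<^sub>C x) = cinner w (c *\<^sub>C t' x)"
    using assms by (simp add: cinner_scaleC_right adjoint_pairing)
  then show ?thesis using adjoint_iff by blast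
qed

text \<open>Normality survives translation and scaling. With \<open>c\<close> the inverse of a
  radius, the localization to the unit disc becomes one to a disc of that radius about
  \<open>\<mu>\<close>.\<close>

lemma (in normal_pair) normal_pair_affine:
  assumes c: "c \<noteq> 0"
  shows "normal_pair D (\<lambda>x. c *\<^sub>C (t x - \<mu> *\<^sub>C x)) (\<lambda>x. cnj c *\<^sub>C (t' x - cnj \<mu> *\<^sub>C x))"
proof
  show "0 \<in> D" by (rule zero_mem)
  show "x + y \<in> D" if "x \<in> D" "y \<in> D" for x y by (rule add_mem[OF that])
  show "d *\<^sub>C x \<in> D" if "x \<in> D" for d x by (rule scale_mem[OF that])
  show "c *\<^sub>C (t (x + y) - \<mu> *\<^sub>C (x + y)) = c *\<^sub>C (t x - \<mu> *\<^sub>C x) + c *\<^sub>C (t y - \<mu> *\<^sub>C y)"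
    if "x \<in> D" "y \<in> D" for x y
    using that by (simp add: t_add scaleC_add_right scaleC_diff_right)
  show "c *\<^sub>C (t (d *\<^sub>C x) - \<mu> *\<^sub>C d *\<^sub>C x) = d *\<^sub>C c *\<^sub>C (t x - \<mu> *\<^sub>C x)" if "x \<in> D" for d x
    using that by (simp add: t_scale scaleC_diff_right scaleC_scaleC ac_simps)
  have solve: "c *\<^sub>C (y - \<mu> *\<^sub>C x) = z \<longleftrightarrow> y = inverse c *\<^sub>C z + \<mu> *\<^sub>C x"
    if "c \<noteq> 0" for c \<mu> and x y z :: 'a
  proof
    assume "c *\<^sub>C (y - \<mu> *\<^sub>C x) = z"
    then have "inverse c *\<^sub>C z = y - \<mu> *\<^sub>C x"
      using that by (auto simp: scaleC_scaleC scaleC_one)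
    then show "y = inverse c *\<^sub>C z + \<mu> *\<^sub>C x" by simp
  next
    assume "y = inverse c *\<^sub>C z + \<mu> *\<^sub>C x"
    then show "c *\<^sub>C (y - \<mu> *\<^sub>C x) = z" using that by (simp add: scaleC_scaleC scaleC_one)
  qed
  \<comment> \<open>The new graph is the preimage of the old one under a continuous map, hence
    closed.\<close>
  have "(\<lambda>x. (x, c *\<^sub>C (t x - \<mu> *\<^sub>C x))) ` D
      = (\<lambda>p. (fst p, inverse c *\<^sub>C snd p + \<mu> *\<^sub>C fst p)) -` (\<lambda>x. (x, t x)) ` D"
    (is "?L = ?R")
  proof (rule set_eqI)
    fix p :: "'a \<times> 'a"
    obtain x z where p: "p = (x, z)" by fastforce
    have "p \<in> ?L \<longleftrightarrow> x \<in> D \<and> c *\<^sub>C (t x - \<mu> *\<^sub>C x) = z" by (auto simp: p)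
    also have "\<dots> \<longleftrightarrow> x \<in> D \<and> t x = inverse c *\<^sub>C z + \<mu> *\<^sub>C x" by (simp only: solve[OF c])
    also have "\<dots> \<longleftrightarrow> p \<in> ?R" by (auto simp: p)
    finally show "p \<in> ?L \<longleftrightarrow> p \<in> ?R" .
  qed
  moreover have "closed \<dots>"
    by (intro closed_vimage closed_graph continuous_intros
        bounded_linear.continuous_on[OF bounded_linear_scaleC])
  ultimately show "closed ((\<lambda>x. (x, c *\<^sub>C (t x - \<mu> *\<^sub>C x))) ` D)" by simp
  show "(\<forall>x\<in>D. cinner (c *\<^sub>C (t x - \<mu> *\<^sub>C x)) y = cinner x z)
      \<longleftrightarrow> y \<in> D \<and> cnj c *\<^sub>C (t' y - cnj \<mu> *\<^sub>C y) = z" for y z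
  proof -
    have "cinner (c *\<^sub>C (t x - \<mu> *\<^sub>C x)) y = cinner x z
        \<longleftrightarrow> cinner (t x) y = cinner x (inverse (cnj c) *\<^sub>C z + cnj \<mu> *\<^sub>C y)" for x
      using c by (auto simp: cinner_scaleC_left cinner_scaleC_right cinner_diff_left
          cinner_add_right field_simps)
    then show ?thesis
      using adjoint_iff[of y "inverse (cnj c) *\<^sub>C z + cnj \<mu> *\<^sub>C y"] solve[of "cnj c" "t' y" "cnj \<mu>" y z] c
      by simp
  qed
  have mem_iff: "c *\<^sub>C (y - \<mu> *\<^sub>C x) \<in> D \<longleftrightarrow> y \<in> D" if "x \<in> D" "c \<noteq> 0" for c \<mu> x y
  proof
    assume "c *\<^sub>C (y - \<mu> *\<^sub>C x) \<in> D"
    from add_mem[OF scale_mem[OF this, of "inverse c"] scale_mem[OF that(1), of \<mu>]]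
    show "y \<in> D" using that(2) by (simp add: scaleC_scaleC scaleC_one)
  qed (use that in \<open>intro scale_mem diff_mem\<close>)
  show "c *\<^sub>C (t x - \<mu> *\<^sub>C x) \<in> D \<longleftrightarrow> cnj c *\<^sub>C (t' x - cnj \<mu> *\<^sub>C x) \<in> D" if "x \<in> D" for x
    using that c by (simp add: mem_iff comm_dom)
  show "c *\<^sub>C (t (cnj c *\<^sub>C (t' x - cnj \<mu> *\<^sub>C x)) - \<mu> *\<^sub>C cnj c *\<^sub>C (t' x - cnj \<mu> *\<^sub>C x))
      = cnj c *\<^sub>C (t' (c *\<^sub>C (t x - \<mu> *\<^sub>C x)) - cnj \<mu> *\<^sub>C c *\<^sub>C (t x - \<mu> *\<^sub>C x))"
    if x: "x \<in> D" and "c *\<^sub>C (t x - \<mu> *\<^sub>C x) \<in> D" for x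
  proof -
    have tx: "t x \<in> D" using that(2) mem_iff[OF x c] by simp
    then have t'x: "t' x \<in> D" using comm_dom[OF x] by simp
    have "c *\<^sub>C (t (cnj c *\<^sub>C (t' x - cnj \<mu> *\<^sub>C x)) - \<mu> *\<^sub>C cnj c *\<^sub>C (t' x - cnj \<mu> *\<^sub>C x))
        = (c * cnj c) *\<^sub>C (t (t' x) - cnj \<mu> *\<^sub>C t x - (\<mu> *\<^sub>C t' x - (\<mu> * cnj \<mu>) *\<^sub>C x))"
      using x tx t'x by (simp add: t_scale t_diff diff_mem scale_mem scaleC_diff_right scaleC_scaleC ac_simps)
    also have "\<dots> = (c * cnj c) *\<^sub>C (t' (t x) - \<mu> *\<^sub>C t' x - (cnj \<mu> *\<^sub>C t x - (\<mu> * cnj \<mu>) *\<^sub>C x))"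
      using comm[OF x tx] by (simp add: algebra_simps)
    also have "\<dots> = cnj c *\<^sub>C (t' (c *\<^sub>C (t x - \<mu> *\<^sub>C x)) - cnj \<mu> *\<^sub>C c *\<^sub>C (t x - \<mu> *\<^sub>C x))"
      using x tx by (simp add: adj_scale adj_diff diff_mem scale_mem scaleC_diff_right scaleC_scaleC ac_simps)
    finally show ?thesis .
  qed
qed

lemma graph_eq_image: "Map.graph T = (\<lambda>x. (x, the (T x))) ` dom T"
  by (auto simp: Map.graph_def dom_def image_iff)

lemma closed_linear_of_operator:
  fixes T :: "'a::chilbert_space \<rightharpoonup> 'a"
  assumes "linear_operator T" "closed_operator T"
  shows "closed_linear (dom T) (\<lambda>x. the (T x))"
proof
  show "closed ((\<lambda>x. (x, the (T x))) ` dom T)"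
    using assms(2) by (simp add: closed_operator_def graph_eq_image)
next
  have add: "T (x + y) = Some (the (T x) + the (T y))" if "x \<in> dom T" "y \<in> dom T" for x y
    using assms(1) that by (simp add: linear_operator_def)
  show "x + y \<in> dom T" "the (T (x + y)) = the (T x) + the (T y)"
    if "x \<in> dom T" "y \<in> dom T" for x y
    using add[OF that] by auto
  have scale: "T (c *\<^sub>C x) = Some (c *\<^sub>C the (T x))" if "x \<in> dom T" for c x
    using assms(1) that by (simp add: linear_operator_def)
  show "c *\<^sub>C x \<in> dom T" "the (T (c *\<^sub>C x)) = c *\<^sub>C the (T x)" if "x \<in> dom T" for c x
    using scale[OF that, of c] by auto
qed (use assms(1) in \<open>simp add: linear_operator_def\<close>)

lemma adjoint_operator_pairing:
  assumes "densely_defined T" "x \<in> dom T" "y \<in> dom (adjoint_operator T)"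
  shows "cinner (the (T x)) y = cinner x (the (adjoint_operator T y))"
proof -
  obtain z where z: "adjoint_operator T y = Some z" using assms(3) by blast
  then have "cinner (the (T x)) y = cinner x z"
    using assms(2) adjoint_operator_eq_Some_iff[OF assms(1)] by blast
  then show ?thesis by (simp add: z)
qed

text \<open>The graph of an adjoint is cut out by continuous equations, two real ones for each
  \<open>x\<close> in the domain. Self-adjoint operators inherit closedness from this.\<close>

lemma closed_linear_adjoint:
  fixes T :: "'a::chilbert_space \<rightharpoonup> 'a"
  assumes T: "densely_defined T"
  shows "closed_linear (dom (adjoint_operator T)) (\<lambda>x. the (adjoint_operator T x))"
proof (rule closed_linear_of_operator)
  note iff = adjoint_operator_eq_Some_iff[OF T]
  show "linear_operator (adjoint_operator T)"
    unfolding linear_operator_def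
  proof (intro conjI ballI allI)
    have "adjoint_operator T 0 = Some 0" by (simp add: iff cinner_zero_right)
    then show "0 \<in> dom (adjoint_operator T)" by blast
  next
    fix x y assume "x \<in> dom (adjoint_operator T)" "y \<in> dom (adjoint_operator T)"
    then show "adjoint_operator T (x + y)
        = Some (the (adjoint_operator T x) + the (adjoint_operator T y))"
      by (simp add: iff cinner_add_right adjoint_operator_pairing[OF T])
  next
    fix c x assume "x \<in> dom (adjoint_operator T)"
    then show "adjoint_operator T (c *\<^sub>C x) = Some (c *\<^sub>C the (adjoint_operator T x))"
      by (simp add: iff cinner_scaleC_right adjoint_operator_pairing[OF T])
  qed
  have "Map.graph (adjoint_operator T)
      = (\<Inter>x\<in>dom T. {p. inner (the (T x)) (fst p) = inner x (snd p)
          \<and> inner (the (T x)) (\<i> *\<^sub>C fst p) = inner x (\<i> *\<^sub>C snd p)})"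
    (is "_ = ?S")
  proof (rule set_eqI)
    show "p \<in> Map.graph (adjoint_operator T) \<longleftrightarrow> p \<in> ?S" for p
      by (cases p) (simp add: Map.graph_def iff cinner_eq_Complex del: domIff)
  qed
  moreover have "closed \<dots>"
    by (intro closed_INT ballI closed_Collect_conj closed_Collect_eq continuous_intros
        bounded_linear.continuous_on[OF bounded_linear_scaleC])
  ultimately show "closed_operator (adjoint_operator T)"
    by (simp add: closed_operator_def)
qed

text \<open>Approximate \<open>x\<close> in the graph norm of \<open>p\<close> by elements of
  \<open>E\<close>. Equality of the norms on differences makes the images under \<open>q\<close>
  Cauchy too, and closedness of \<open>q\<close> places \<open>x\<close> in
  \<open>Q\<close>.\<close>

lemma dom_subset_of_core:
  assumes "closed_linear P p" "closed_linear Q q"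
    and E: "E \<subseteq> P" "E \<subseteq> Q" and eq: "\<And>x y. x \<in> E \<Longrightarrow> y \<in> E \<Longrightarrow> norm (p (x - y)) = norm (q (x - y))"
    and core: "(\<lambda>x. (x, p x)) ` P \<subseteq> closure ((\<lambda>x. (x, p x)) ` E)"
  shows "P \<subseteq> Q"
proof
  interpret P: closed_linear P p by fact
  interpret Q: closed_linear Q q by fact
  fix x assume "x \<in> P"
  then have "(x, p x) \<in> closure ((\<lambda>x. (x, p x)) ` E)" using core by blast
  then obtain f where f: "\<forall>n. f n \<in> (\<lambda>x. (x, p x)) ` E" "f \<longlonglongrightarrow> (x, p x)"
    by (auto simp: closure_sequential)
  define e where "e n = fst (f n)" for n
  have e: "e n \<in> E" and pe: "snd (f n) = p (e n)" for n
    using f(1)[rule_format, of n] by (auto simp: e_def)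
  have eP: "e n \<in> P" and eQ: "e n \<in> Q" for n using e[of n] E by blast+
  have ex: "e \<longlonglongrightarrow> x" using tendsto_fst[OF f(2)] unfolding e_def by simp
  have "(\<lambda>n. p (e n)) \<longlonglongrightarrow> p x" using tendsto_snd[OF f(2)] by (simp add: pe)
  then have "Cauchy (\<lambda>n. p (e n))" by (rule LIMSEQ_imp_Cauchy)
  moreover have "dist (p (e m)) (p (e n)) = dist (q (e m)) (q (e n))" for m n
    using eq[OF e e, of m n] P.t_diff[OF eP eP, of m n] Q.t_diff[OF eQ eQ, of m n]
    by (simp add: dist_norm)
  ultimately have "Cauchy (\<lambda>n. q (e n))" by (simp add: Cauchy_def)
  then obtain z where z: "(\<lambda>n. q (e n)) \<longlonglongrightarrow> z" by (auto simp: Cauchy_convergent_iff convergent_def)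
  have "(x, z) \<in> (\<lambda>x. (x, q x)) ` Q"
  proof (rule closed_sequentially[OF Q.closed_graph])
    show "(e n, q (e n)) \<in> (\<lambda>x. (x, q x)) ` Q" for n by (rule imageI[OF eQ])
    show "(\<lambda>n. (e n, q (e n))) \<longlonglongrightarrow> (x, z)" by (rule tendsto_Pair[OF ex z])
  qed
  then show "x \<in> Q" by auto
qed

text \<open>The common domain of \<open>T\<^sup>* T\<close> and \<open>T T\<^sup>*\<close> is a core for both \<open>T\<close> and \<open>T\<^sup>*\<close>, and both have
  the same graph norm there.\<close>

lemma normal_operator_dom_adjoint:
  fixes T :: "'a::chilbert_space \<rightharpoonup> 'a"
  assumes N: "normal_operator T"
  shows "dom (adjoint_operator T) = dom T"
proof -
  define D D' t t' where DD: "D = dom T" "D' = dom (adjoint_operator T)"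
    "t = (\<lambda>x. the (T x))" "t' = (\<lambda>x. the (adjoint_operator T x))"
  have dense: "densely_defined T" using N by (simp add: normal_operator_def)
  interpret T: closed_linear D t
    unfolding DD using N by (intro closed_linear_of_operator) (auto simp: normal_operator_def)
  interpret T': closed_linear D' t'
    unfolding DD using dense by (rule closed_linear_adjoint)
  note pairing = adjoint_operator_pairing[OF dense, folded DD(1,2), folded fun_cong[OF DD(3)] fun_cong[OF DD(4)]]
  have comp: "T \<circ>\<^sub>m adjoint_operator T = adjoint_operator T \<circ>\<^sub>m T"
    using N by (simp add: normal_operator_def)
  define E where "E = {x \<in> D. t x \<in> D'}"
  \<comment> \<open>Equality of the two products includes equality of their domains, which describes
    \<open>E\<close> from the side of the adjoint.\<close>
  have E': "E = {x \<in> D'. t' x \<in> D}"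
    using arg_cong[OF comp, of dom] unfolding dom_operator_product E_def DD by auto
  have tt': "t' (t x) = t (t' x)" if "x \<in> E" for x
  proof -
    have "x \<in> D" "x \<in> D'" using that E' by (auto simp: E_def)
    then show ?thesis using fun_cong[OF comp, of x] by (auto simp: DD map_comp_def)
  qed
  have E_diff: "x - y \<in> E" if "x \<in> E" "y \<in> E" for x y
    using that T.diff_mem T'.diff_mem T.t_diff by (auto simp: E_def)
  have norm_eq: "norm (t x) = norm (t' x)" if x: "x \<in> E" for x
  proof -
    have *: "x \<in> D" "t x \<in> D'" "x \<in> D'" "t' x \<in> D" using x E' by (auto simp: E_def)
    have "cinner (t x) (t x) = cinner x (t' (t x))" using pairing * by blast
    also have "\<dots> = cnj (cinner (t (t' x)) x)" by (metis tt'[OF x] cinner_commute)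
    also have "cinner (t (t' x)) x = cinner (t' x) (t' x)" using pairing * by blast
    finally have "cinner (t x) (t x) = cinner (t' x) (t' x)" by (simp add: cinner_self)
    then have "(norm (t x))\<^sup>2 = (norm (t' x))\<^sup>2" unfolding cinner_self of_real_eq_iff .
    then show ?thesis by simp
  qed
  \<comment> \<open>The range of the resolvent lies in \<open>E\<close>. Testing orthogonality
    against it is enough for both core statements below.\<close>
  have G: "T.G v \<in> E" "t' (t (T.G v)) = v - T.G v" for v
  proof -
    have "\<forall>w\<in>dom T. cinner (the (T w)) (t (T.G v)) = cinner w (v - T.G v)"
      using T.G_cinner[of _ v] unfolding DD(1,3) by (metis cinner_commute)
    then have "adjoint_operator T (t (T.G v)) = Some (v - T.G v)"
      by (simp add: adjoint_operator_eq_Some_iff[OF dense])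
    then show "T.G v \<in> E" "t' (t (T.G v)) = v - T.G v"
      using T.G_mem by (auto simp: E_def DD)
  qed
  have sub: "subspace ((\<lambda>x. (x, t x)) ` E)" "subspace ((\<lambda>x. (x, t' x)) ` E)"
  proof -
    have E0: "0 \<in> E" using T.zero_mem T.t_zero T'.zero_mem by (simp add: E_def)
    have E_add: "x + y \<in> E" if "x \<in> E" "y \<in> E" for x y
      using that T.add_mem T'.add_mem T.t_add by (simp add: E_def)
    have E_scale: "c *\<^sub>C x \<in> E" if "x \<in> E" for c x
      using that T.scale_mem T'.scale_mem T.t_scale by (simp add: E_def)
    have "E \<subseteq> D" "E \<subseteq> D'" using E' by (auto simp: E_def)
    then show "subspace ((\<lambda>x. (x, t x)) ` E)" "subspace ((\<lambda>x. (x, t' x)) ` E)"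
      using T.subspace_graph_on[OF _ E0 E_add E_scale] T'.subspace_graph_on[OF _ E0 E_add E_scale]
      by blast+
  qed
  have "(\<lambda>x. (x, t x)) ` D \<subseteq> closure ((\<lambda>x. (x, t x)) ` E)"
  proof (rule subset_closure_of_orthogonal_trivial[OF sub(1) T.subspace_graph T.closed_graph])
    fix w assume "w \<in> (\<lambda>x. (x, t x)) ` D" and orth: "\<And>v. v \<in> (\<lambda>x. (x, t x)) ` E \<Longrightarrow> inner w v = 0"
    then obtain x where x: "x \<in> D" "w = (x, t x)" by blast
    have "inner v x = 0" for v
      using orth[of "(T.G v, t (T.G v))"] G(1)[of v] T.G_inner[OF x(1), of v] x(2)
      by (simp add: inner_diff_left inner_diff_right inner_commute)
    then have "x = 0" by (metis inner_eq_zero_iff)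
    then show "w = 0" using x(2) T.t_zero by (simp add: zero_prod_def)
  qed (auto simp: E_def)
  then have "D \<subseteq> D'"
    using E' norm_eq E_diff
    by (intro dom_subset_of_core[of D t D' t' E] T.closed_linear_axioms T'.closed_linear_axioms)
      (auto simp: E_def)
  moreover have "(\<lambda>x. (x, t' x)) ` D' \<subseteq> closure ((\<lambda>x. (x, t' x)) ` E)"
  proof (rule subset_closure_of_orthogonal_trivial[OF sub(2) T'.subspace_graph T'.closed_graph])
    fix w assume "w \<in> (\<lambda>x. (x, t' x)) ` D'" and orth: "\<And>v. v \<in> (\<lambda>x. (x, t' x)) ` E \<Longrightarrow> inner w v = 0"
    then obtain x where x: "x \<in> D'" "w = (x, t' x)" by blast
    have "inner v x = 0" for v
    proof -
      define g where "g = T.G v"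
      \<comment> \<open>Normality turns \<open>t' (t g) = v - g\<close> into an equation for
        \<open>t (t' g)\<close>, so the resolvent of \<open>T\<close> also serves for the adjoint:
        orthogonality to \<open>(g, t' g)\<close> reduces to \<open>inner x v = 0\<close>.\<close>
      have g: "g \<in> E" "t (t' g) = v - g" using G[of v] tt'[OF G(1)[of v]] by (simp_all add: g_def)
      have "inner x g + inner (t' x) (t' g) = 0" using orth[of "(g, t' g)"] g(1) x(2) by simp
      moreover have "inner (t' x) (t' g) = inner x (t (t' g))"
      proof -
        have "cinner (t (t' g)) x = cinner (t' g) (t' x)"
          using pairing x(1) g(1) E' by blast
        then have "inner (t (t' g)) x = inner (t' g) (t' x)" by (simp add: inner_eq_Re_cinner)
        then show ?thesis by (simp add: inner_commute)
      qed
      ultimately show ?thesis using g(2) by (simp add: inner_diff_right inner_commute)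
    qed
    then have "x = 0" by (metis inner_eq_zero_iff)
    then show "w = 0" using x(2) T'.t_zero by (simp add: zero_prod_def)
  qed (auto simp: E')
  then have "D' \<subseteq> D"
    using E' norm_eq E_diff
    by (intro dom_subset_of_core[of D' t' D t E] T.closed_linear_axioms T'.closed_linear_axioms)
      (auto simp: E_def)
  ultimately show ?thesis by (simp add: DD)
qed

lemma normal_pair_of_operator:
  fixes T :: "'a::chilbert_space \<rightharpoonup> 'a"
  assumes N: "normal_operator T"
  shows "normal_pair (dom T) (\<lambda>x. the (T x)) (\<lambda>x. the (adjoint_operator T x))"
proof -
  note dom_eq = normal_operator_dom_adjoint[OF N]
  have dense: "densely_defined T" using N by (simp add: normal_operator_def)
  interpret closed_linear "dom T" "\<lambda>x. the (T x)"
    using N by (intro closed_linear_of_operator) (auto simp: normal_operator_def)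
  have comp: "T \<circ>\<^sub>m adjoint_operator T = adjoint_operator T \<circ>\<^sub>m T"
    using N by (simp add: normal_operator_def)
  show ?thesis
  proof
    fix y z
    have "(\<forall>x\<in>dom T. cinner (the (T x)) y = cinner x z) \<longleftrightarrow> adjoint_operator T y = Some z"
      by (simp add: adjoint_operator_eq_Some_iff[OF dense])
    also have "\<dots> \<longleftrightarrow> y \<in> dom T \<and> the (adjoint_operator T y) = z"
      unfolding dom_eq[symmetric] by auto
    finally show "(\<forall>x\<in>dom T. cinner (the (T x)) y = cinner x z)
        \<longleftrightarrow> y \<in> dom T \<and> the (adjoint_operator T y) = z" .
  next
    fix x assume x: "x \<in> dom T"
    show iff: "the (T x) \<in> dom T \<longleftrightarrow> the (adjoint_operator T x) \<in> dom T"
      using arg_cong[OF comp, of dom] x dom_eq unfolding dom_operator_product by auto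
    assume "the (T x) \<in> dom T"
    moreover have "x \<in> dom (adjoint_operator T)" using x dom_eq by simp
    ultimately show "the (T (the (adjoint_operator T x))) = the (adjoint_operator T (the (T x)))"
      using x fun_cong[OF comp, of x] by (auto simp: map_comp_def)
  qed
qed

section \<open>Products of a positive and a bounded self-adjoint operator\<close>

locale positive_product =
  fixes A B :: "'a::chilbert_space \<rightharpoonup> 'a"
  assumes B_bounded: "bounded_operator B" and B_self_adjoint: "self_adjoint B"
    and A_self_adjoint: "self_adjoint A" and A_positive: "positive_operator A"
    and AB_normal: "normal_operator (A \<circ>\<^sub>m B)"
begin

section \<open>Total functions for the operators and their adjoint relations\<close>

definition a :: "'a \<Rightarrow> 'a" where "a x = the (A x)"
definition b :: "'a \<Rightarrow> 'a" where "b x = the (B x)"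
definition n :: "'a \<Rightarrow> 'a" where "n x = the ((A \<circ>\<^sub>m B) x)"
definition n' :: "'a \<Rightarrow> 'a" where "n' x = the (adjoint_operator (A \<circ>\<^sub>m B) x)"
definition D :: "'a set" where "D = dom (A \<circ>\<^sub>m B)"

lemma B_eq: "B x = Some (b x)"
proof -
  have "x \<in> dom B" using B_bounded by (simp add: bounded_operator_def)
  then show ?thesis by (auto simp: b_def)
qed

lemma A_eq: "x \<in> dom A \<Longrightarrow> A x = Some (a x)"
  by (auto simp: a_def)

lemma mem_D: "x \<in> D \<longleftrightarrow> b x \<in> dom A"
  by (simp add: D_def dom_def map_comp_def B_eq)

lemma n_eq: "n x = a (b x)"
  by (simp add: n_def a_def map_comp_def B_eq)

text \<open>\<open>A\<close> is its own adjoint, and adjoints are closed and linear.\<close>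

sublocale A: closed_linear "dom A" a
proof -
  have "densely_defined A" "A = adjoint_operator A"
    using A_self_adjoint by (simp_all add: self_adjoint_def)
  then show "closed_linear (dom A) a"
    unfolding a_def[abs_def] using closed_linear_adjoint[of A] by simp
qed

sublocale B: closed_linear UNIV b
proof -
  have "densely_defined B" "B = adjoint_operator B" "dom B = UNIV"
    using B_self_adjoint B_bounded by (simp_all add: self_adjoint_def bounded_operator_def)
  then show "closed_linear UNIV b"
    unfolding b_def[abs_def] using closed_linear_adjoint[of B] by simp
qed

sublocale N: normal_pair D n n'
  using normal_pair_of_operator[OF AB_normal] by (simp add: D_def n_def[abs_def] n'_def[abs_def])

text \<open>Beyond symmetry, the direction from right to left lets a weak identity prove membership
  in \<open>dom A\<close>.\<close>

lemma a_adjoint: "A y = Some z \<longleftrightarrow> (\<forall>x\<in>dom A. cinner (a x) y = cinner x z)"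
proof -
  have dense: "densely_defined A" and eq: "adjoint_operator A = A"
    using A_self_adjoint by (simp_all add: self_adjoint_def)
  show ?thesis
    using adjoint_operator_eq_Some_iff[OF dense, of y z] unfolding eq a_def .
qed

lemma a_pairing: "x \<in> dom A \<Longrightarrow> y \<in> dom A \<Longrightarrow> cinner (a x) y = cinner x (a y)"
  using a_adjoint[of y "a y"] A_eq by blast

lemma b_pairing: "cinner (b x) y = cinner x (b y)"
proof -
  have dense: "densely_defined B" and eq: "adjoint_operator B = B" and "dom B = UNIV"
    using B_self_adjoint B_bounded by (simp_all add: self_adjoint_def bounded_operator_def)
  then show ?thesis
    using adjoint_operator_eq_Some_iff[OF dense, of y "b y"] unfolding eq b_def
    by (simp add: B_eq)
qed

lemma b_bound: "\<exists>K\<ge>0. \<forall>x. norm (b x) \<le> K * norm x"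
proof -
  obtain K where K: "\<And>x. norm (b x) \<le> K * norm x"
    using B_bounded unfolding bounded_operator_def b_def by blast
  have "norm (b x) \<le> \<bar>K\<bar> * norm x" for x
    by (rule order_trans[OF K mult_right_mono]) auto
  then show ?thesis using abs_ge_zero by blast
qed

section \<open>Positivity of \<open>A\<close> and density of its domain\<close>

lemma a_nonneg: "x \<in> dom A \<Longrightarrow> 0 \<le> inner (a x) x"
  using A_positive by (auto simp: positive_operator_def a_def inner_eq_Re_cinner complex_nonneg_Reals_iff)

lemma dom_A_dense: "(\<And>v. v \<in> dom A \<Longrightarrow> inner u v = 0) \<Longrightarrow> u = 0"
proof -
  assume "\<And>v. v \<in> dom A \<Longrightarrow> inner u v = 0"
  then have "closure (dom A) \<subseteq> {v. inner u v = 0}"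
    by (intro closure_minimal closed_Collect_eq continuous_intros) auto
  moreover have "closure (dom A) = UNIV"
    using A_self_adjoint by (simp add: self_adjoint_def densely_defined_def)
  ultimately have "inner u u = 0" by blast
  then show "u = 0" by simp
qed

text \<open>A null vector of a nonnegative form is orthogonal to everything in that form; density of
  \<open>dom A\<close> then gives \<open>a u = 0\<close>.\<close>

lemma a_eq_zero:
  assumes u: "u \<in> dom A" "inner (a u) u = 0"
  shows "a u = 0"
proof (rule dom_A_dense, rule ccontr)
  fix v assume v: "v \<in> dom A" and "inner (a u) v \<noteq> 0"
  \<comment> \<open>A real step \<open>s\<close> at which \<open>2 * s * c + s * s * q\<close> is
    negative. The denominator \<open>q + 1\<close> stays positive even when
    \<open>q = 0\<close>.\<close>
  define c q s where cqs: "c = inner (a u) v" "q = inner (a v) v" "s = - c / (q + 1)"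
  have c: "c \<noteq> 0" and q: "0 \<le> q"
    using \<open>inner (a u) v \<noteq> 0\<close> a_nonneg[OF v] by (simp_all add: cqs)
  have sv: "s *\<^sub>R v \<in> dom A" "a (s *\<^sub>R v) = s *\<^sub>R a v"
    using A.scale_mem[OF v] A.t_scale[OF v] by (simp_all add: scaleR_eq_scaleC)
  have "inner (a v) u = c"
    using arg_cong[OF a_pairing[OF v u(1)], of Re]
    unfolding cqs(1) inner_eq_Re_cinner[symmetric] by (simp add: inner_commute)
  have "0 \<le> inner (a (u + s *\<^sub>R v)) (u + s *\<^sub>R v)"
    by (intro a_nonneg A.add_mem u sv)
  also have "\<dots> = 2 * s * c + s * s * q"
    using u(2) \<open>inner (a v) u = c\<close>
    by (simp add: A.t_add[OF u(1) sv(1)] sv(2) inner_add_left inner_add_right cqs(1,2) algebra_simps)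
  also have "c = - (q + 1) * s"
  proof -
    have "q + 1 \<noteq> 0" using q by linarith
    then have "s * (q + 1) = - c" by (rule nonzero_eq_divide_eq[THEN iffD1, OF _ cqs(3)])
    then show ?thesis by (simp add: algebra_simps)
  qed
  also have "2 * s * (- (q + 1) * s) + s * s * q = - (s\<^sup>2 * (q + 2))"
    by (simp add: algebra_simps power2_eq_square)
  finally have "s\<^sup>2 * (q + 2) \<le> 0" by simp
  moreover have "0 < s\<^sup>2 * (q + 2)" using c q by (simp add: cqs(3))
  ultimately show False by linarith
qed

section \<open>The form \<open>h\<close> and lower bounds for imaginary shifts of
  \<open>n\<close>\<close>

definition h :: "'a \<Rightarrow> 'a \<Rightarrow> complex" where "h x y = cinner (b x) (n y)"

lemma h_nonneg: "x \<in> D \<Longrightarrow> 0 \<le> Re (h x x)"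
  using a_nonneg[of "b x"] by (simp add: h_def n_eq mem_D inner_eq_Re_cinner[symmetric] inner_commute)

text \<open>Move \<open>B\<close> across, then \<open>A\<close>; the latter is allowed because
  \<open>n x \<in> D\<close> means \<open>b (n x) \<in> dom A\<close>. Symmetry of \<open>n\<close>
  in the original inner product is still unknown here.\<close>

lemma h_symmetric:
  assumes "x \<in> D" "n x \<in> D"
  shows "h (n x) x = h x (n x)"
proof -
  have "h (n x) x = cinner (n x) (b (n x))" by (simp add: h_def b_pairing)
  also have "\<dots> = cinner (b x) (a (b (n x)))"
    using assms a_pairing[of "b x" "b (n x)"] by (simp add: mem_D n_eq)
  finally show ?thesis by (simp add: h_def n_eq)
qed

text \<open>The cross terms cancel by symmetry.\<close>

lemma h_shift:
  fixes x :: 'a and \<beta> :: real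
  assumes x: "x \<in> D" "n x \<in> D"
  defines "y \<equiv> n x - (\<i> * complex_of_real \<beta>) *\<^sub>C x"
  shows "\<beta>\<^sup>2 * Re (h x x) \<le> Re (h y y)"
proof -
  define \<mu> where "\<mu> = \<i> * complex_of_real \<beta>"
  have sx: "\<mu> *\<^sub>C x \<in> D" using x by (intro N.scale_mem)
  have "h y y = h (n x) (n x) + (\<mu> * cnj \<mu>) * h x x - (cnj \<mu> * h (n x) x + \<mu> * h x (n x))"
    unfolding y_def \<mu>_def[symmetric] h_def
    by (simp add: B.t_diff[OF UNIV_I UNIV_I] B.t_scale N.t_diff[OF x(2) sx] N.t_scale[OF x(1)]
        cinner_diff_left cinner_diff_right cinner_scaleC_left cinner_scaleC_right algebra_simps)
  also have "cnj \<mu> * h (n x) x + \<mu> * h x (n x) = 0"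
    unfolding h_symmetric[OF x] by (simp add: \<mu>_def)
  also have "\<mu> * cnj \<mu> = complex_of_real (\<beta>\<^sup>2)"
    by (simp add: \<mu>_def power2_eq_square complex_eq_iff)
  finally have "Re (h y y) = Re (h (n x) (n x)) + \<beta>\<^sup>2 * Re (h x x)" by simp
  then show ?thesis using h_nonneg[OF x(2)] by linarith
qed

text \<open>A violation yields a nonzero subspace \<open>L\<close> on which
  \<open>t = (n - \<mu>) / \<epsilon>\<close> is a contraction, although \<open>t\<close> stretches
  \<open>h\<close> by the factor \<open>(\<beta> / \<epsilon>)\<^sup>2 > 1\<close>.\<close>

lemma norm_shift_lower_bound_less:
  assumes x0: "x0 \<in> D" and \<epsilon>: "0 < \<epsilon>" "\<epsilon> < \<bar>\<beta>\<bar>"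
  shows "\<epsilon> * norm x0 \<le> norm (n x0 - (\<i> * complex_of_real \<beta>) *\<^sub>C x0)"
proof (rule ccontr)
  assume neg: "\<not> ?thesis"
  define \<mu> where "\<mu> = \<i> * complex_of_real \<beta>"
  define c where "c = complex_of_real (1 / \<epsilon>)"
  define t where "t x = c *\<^sub>C (n x - \<mu> *\<^sub>C x)" for x
  have c: "c \<noteq> 0" "cmod c = 1 / \<epsilon>" using \<epsilon> by (simp_all add: c_def norm_divide)
  interpret T: normal_pair D t "\<lambda>x. cnj c *\<^sub>C (n' x - cnj \<mu> *\<^sub>C x)"
    unfolding t_def[abs_def] by (rule N.normal_pair_affine[OF c(1)])
  have less: "norm (t x0) < norm x0"
    using neg \<epsilon> by (simp add: t_def norm_scaleC c \<mu>_def field_simps)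
  obtain L where "L \<subseteq> D \<and> (\<exists>x\<in>L. x \<noteq> 0) \<and> (\<forall>x\<in>L. \<forall>y\<in>L. x + y \<in> L)
    \<and> (\<forall>c. \<forall>x\<in>L. c *\<^sub>C x \<in> L) \<and> (\<forall>x\<in>L. t x \<in> L \<and> norm (t x) \<le> norm x)"
    using T.spectral_localization[OF x0 less] ..
  then have L: "L \<subseteq> D" "\<exists>x\<in>L. x \<noteq> 0"
    "\<And>x y. x \<in> L \<Longrightarrow> y \<in> L \<Longrightarrow> x + y \<in> L" "\<And>c x. x \<in> L \<Longrightarrow> c *\<^sub>C x \<in> L"
    "\<And>x. x \<in> L \<Longrightarrow> t x \<in> L" "\<And>x. x \<in> L \<Longrightarrow> norm (t x) \<le> norm x"
    by simp_all
  obtain x where x: "x \<in> L" "x \<noteq> 0" using L(2) by blast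
  have n_t: "n y = complex_of_real \<epsilon> *\<^sub>C t y + \<mu> *\<^sub>C y" for y
    using \<epsilon> by (simp add: t_def c_def scaleC_scaleC scaleC_one flip: of_real_mult)
  have nL: "n y \<in> L" if "y \<in> L" for y
    unfolding n_t by (intro L that)
  have n_bound: "norm (n y) \<le> (\<epsilon> + \<bar>\<beta>\<bar>) * norm y" if "y \<in> L" for y
  proof -
    have "norm (n y) \<le> \<epsilon> * norm (t y) + \<bar>\<beta>\<bar> * norm y"
      unfolding n_t using norm_triangle_ineq[of "complex_of_real \<epsilon> *\<^sub>C t y" "\<mu> *\<^sub>C y"] \<epsilon>
      by (simp add: norm_scaleC \<mu>_def norm_mult)
    also have "\<dots> \<le> \<epsilon> * norm y + \<bar>\<beta>\<bar> * norm y"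
      using L(6)[OF that] \<epsilon> by simp
    finally show ?thesis by (simp add: algebra_simps)
  qed
  obtain K where K: "0 \<le> K" "\<And>x. norm (b x) \<le> K * norm x" using b_bound by blast
  \<comment> \<open>On \<open>L\<close> the operator \<open>n\<close> is bounded, so the form is
    controlled by the norm there.\<close>
  have h_bound: "Re (h y y) \<le> K * (\<epsilon> + \<bar>\<beta>\<bar>) * (norm y)\<^sup>2" if "y \<in> L" for y
  proof -
    have "Re (h y y) \<le> norm (b y) * norm (n y)"
      unfolding h_def inner_eq_Re_cinner[symmetric] by (rule norm_cauchy_schwarz)
    also have "\<dots> \<le> (K * norm y) * ((\<epsilon> + \<bar>\<beta>\<bar>) * norm y)"
      using K n_bound[OF that] by (intro mult_mono) auto
    finally show ?thesis by (simp add: power2_eq_square algebra_simps)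
  qed
  define r where "r = (\<beta> / \<epsilon>)\<^sup>2"
  have "\<epsilon>\<^sup>2 < \<beta>\<^sup>2" using \<epsilon> power_strict_mono[of \<epsilon> "\<bar>\<beta>\<bar>" 2] by simp
  then have r: "1 < r" using \<epsilon> by (simp add: r_def power_divide)
  have grow: "r * Re (h y y) \<le> Re (h (t y) (t y))" if "y \<in> L" for y
  proof -
    have yD: "y \<in> D" "n y \<in> D" using L(1) that nL by blast+
    have "n y - \<mu> *\<^sub>C y \<in> D" using yD by (intro N.diff_mem N.scale_mem)
    then have "h (t y) (t y) = (c * cnj c) * h (n y - \<mu> *\<^sub>C y) (n y - \<mu> *\<^sub>C y)"
      by (simp add: h_def t_def B.t_scale N.t_scale cinner_scaleC_left cinner_scaleC_right)
    also have "c * cnj c = complex_of_real (1 / \<epsilon>\<^sup>2)"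
      by (simp add: c_def power2_eq_square)
    finally have "Re (h (t y) (t y)) = Re (h (n y - \<mu> *\<^sub>C y) (n y - \<mu> *\<^sub>C y)) / \<epsilon>\<^sup>2"
      by (simp add: Re_divide_of_real flip: of_real_power)
    then show ?thesis
      using h_shift[OF yD, of \<beta>] \<epsilon> by (simp add: \<mu>_def r_def power_divide divide_right_mono)
  qed
  have iter: "(t ^^ k) x \<in> L \<and> norm ((t ^^ k) x) \<le> norm x
      \<and> r ^ k * Re (h x x) \<le> Re (h ((t ^^ k) x) ((t ^^ k) x))" for k
  proof (induction k)
    case (Suc k)
    define y where "y = (t ^^ k) x"
    have y: "y \<in> L" "norm y \<le> norm x" "r ^ k * Re (h x x) \<le> Re (h y y)"
      using Suc by (simp_all add: y_def)
    have "r * (r ^ k * Re (h x x)) \<le> r * Re (h y y)"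
      using y(3) r by (intro mult_left_mono) auto
    also have "\<dots> \<le> Re (h (t y) (t y))" by (rule grow[OF y(1)])
    finally show ?case
      using L(5,6)[OF y(1)] y(2) by (auto simp: y_def[symmetric] mult.assoc)
  qed (use x in simp)
  \<comment> \<open>A positive value would grow geometrically along the orbit of \<open>x\<close>,
    whose norms stay below \<open>norm x\<close>.\<close>
  have "Re (h x x) \<le> 0"
  proof (rule ccontr)
    assume "\<not> Re (h x x) \<le> 0"
    then have pos: "0 < Re (h x x)" by simp
    define C where "C = K * (\<epsilon> + \<bar>\<beta>\<bar>) * (norm x)\<^sup>2"
    obtain k where k: "C / Re (h x x) < r ^ k" using real_arch_pow[OF r] by blast
    have "r ^ k * Re (h x x) \<le> K * (\<epsilon> + \<bar>\<beta>\<bar>) * (norm ((t ^^ k) x))\<^sup>2"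
      using iter[of k] h_bound by (meson order_trans)
    also have "\<dots> \<le> C"
      unfolding C_def using iter[of k] K(1) \<epsilon> by (intro mult_left_mono power_mono) auto
    finally show False using k pos by (simp add: field_simps)
  qed
  moreover have xD: "x \<in> D" using x L(1) by blast
  ultimately have "Re (h x x) = 0" using h_nonneg[OF xD] by linarith
  then have "n x = 0"
    using a_eq_zero[of "b x"] xD
    by (simp add: h_def n_eq mem_D inner_eq_Re_cinner[symmetric] inner_commute)
  \<comment> \<open>Once \<open>n x = 0\<close>, only the shift remains in \<open>t x\<close>, and
    it is too long for a contraction.\<close>
  then have "norm (t x) = \<bar>\<beta>\<bar> / \<epsilon> * norm x"
    using norm_scaleC[of "-1" "\<mu> *\<^sub>C x"]
    by (simp add: t_def norm_scaleC c \<mu>_def norm_mult)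
  also have "\<dots> > norm x" using \<epsilon> x(2) by (simp add: field_simps)
  finally show False using L(6)[OF x(1)] by simp
qed

lemma norm_shift_lower_bound:
  assumes "x \<in> D"
  shows "\<bar>\<beta>\<bar> * norm x \<le> norm (n x - (\<i> * complex_of_real \<beta>) *\<^sub>C x)"
proof (cases "\<beta> = 0 \<or> x = 0")
  case False
  show ?thesis
  \<comment> \<open>Approach the bound from below, with \<open>z / norm x\<close> in the role of
    \<open>\<epsilon>\<close>.\<close>
  proof (rule dense_le)
    fix z assume z: "z < \<bar>\<beta>\<bar> * norm x"
    show "z \<le> norm (n x - (\<i> * complex_of_real \<beta>) *\<^sub>C x)"
    proof (cases "0 < z")
      case True
      then have "z / norm x * norm x \<le> norm (n x - (\<i> * complex_of_real \<beta>) *\<^sub>C x)"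
        using False z assms by (intro norm_shift_lower_bound_less) (auto simp: field_simps)
      then show ?thesis using False by simp
    next
      case False
      then show ?thesis using norm_ge_zero[of "n x - (\<i> * complex_of_real \<beta>) *\<^sub>C x"] by linarith
    qed
  qed
qed auto

section \<open>Symmetry of \<open>n\<close> and self-adjointness of \<open>AB\<close>\<close>

lemma Im_cinner_n:
  assumes x: "x \<in> D"
  shows "inner (n x) (\<i> *\<^sub>C x) = 0"
proof -
  define q where "q = inner (n x) (\<i> *\<^sub>C x)"
  \<comment> \<open>Squaring the lower bound cancels the terms
    \<open>\<beta>\<^sup>2 * (norm x)\<^sup>2\<close>. What remains is linear in
    \<open>\<beta>\<close> on the left and constant on the right, so \<open>q\<close> must
    vanish.\<close>
  have *: "2 * \<beta> * q \<le> (norm (n x))\<^sup>2" for \<beta> :: real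
  proof -
    have eq: "(\<i> * complex_of_real \<beta>) *\<^sub>C x = \<beta> *\<^sub>R (\<i> *\<^sub>C x)"
      by (simp add: scaleR_eq_scaleC scaleC_scaleC mult.commute)
    have "(\<bar>\<beta>\<bar> * norm x)\<^sup>2 \<le> (norm (n x - (\<i> * complex_of_real \<beta>) *\<^sub>C x))\<^sup>2"
      by (intro power_mono norm_shift_lower_bound x) simp
    also have "\<dots> = (norm (n x))\<^sup>2 - 2 * \<beta> * q + \<beta>\<^sup>2 * (norm x)\<^sup>2"
      unfolding eq q_def power2_norm_eq_inner
      by (simp add: inner_diff_left inner_diff_right inner_commute inner_ii_ii power2_eq_square)
    finally show ?thesis by (simp add: power_mult_distrib)
  qed
  have "q = 0"
  proof (rule ccontr)
    assume q: "q \<noteq> 0"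
    have "2 * (((norm (n x))\<^sup>2 + 1) / (2 * q)) * q = (norm (n x))\<^sup>2 + 1" using q by simp
    then show False using *[of "((norm (n x))\<^sup>2 + 1) / (2 * q)"] by linarith
  qed
  then show ?thesis by (simp add: q_def)
qed

text \<open>Polarization: the vanishing imaginary part at \<open>x + y\<close> gives the imaginary
  part of the identity, and replacing \<open>y\<close> by \<open>\<i> *\<^sub>C y\<close> gives the
  real part.\<close>

lemma n_symmetric:
  assumes x: "x \<in> D" and y: "y \<in> D"
  shows "cinner (n x) y = cinner x (n y)"
proof -
  have im: "inner (n x) (\<i> *\<^sub>C y) + inner (n y) (\<i> *\<^sub>C x) = 0" if "x \<in> D" "y \<in> D" for x y
    using Im_cinner_n[OF N.add_mem[OF that]] Im_cinner_n[OF that(1)] Im_cinner_n[OF that(2)]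
    by (simp add: N.t_add[OF that] scaleC_add_right inner_add_left inner_add_right)
  have im_swap: "inner u (\<i> *\<^sub>C v) = - inner v (\<i> *\<^sub>C u)" for u v :: 'a
    using inner_ii_ii[of u "\<i> *\<^sub>C v"]
    by (simp add: scaleC_scaleC scaleC_minus_one inner_commute)
  have 1: "inner (n x) (\<i> *\<^sub>C y) = inner x (\<i> *\<^sub>C n y)"
    using im[OF x y] im_swap[of x "n y"] by linarith
  have iy: "\<i> *\<^sub>C y \<in> D" by (rule N.scale_mem[OF y])
  have "inner (n x) (\<i> *\<^sub>C \<i> *\<^sub>C y) + inner (\<i> *\<^sub>C n y) (\<i> *\<^sub>C x) = 0"
    using im[OF x iy] by (simp add: N.t_scale[OF y])
  then have "inner (n x) y = inner x (n y)"
    by (simp add: scaleC_scaleC scaleC_minus_one inner_ii_ii inner_commute)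
  with 1 show ?thesis by (simp add: cinner_eq_Complex)
qed

text \<open>Symmetry puts \<open>AB\<close> inside its adjoint, and for a normal operator both have
  the same domain.\<close>

lemma self_adjoint_AB: "self_adjoint (A \<circ>\<^sub>m B)"
proof -
  have dense: "densely_defined (A \<circ>\<^sub>m B)" and lin: "linear_operator (A \<circ>\<^sub>m B)"
    using AB_normal by (simp_all add: normal_operator_def)
  have "(A \<circ>\<^sub>m B) x = adjoint_operator (A \<circ>\<^sub>m B) x" for x
  proof (cases "x \<in> D")
    case True
    have "adjoint_operator (A \<circ>\<^sub>m B) x = Some (n x)"
      unfolding adjoint_operator_eq_Some_iff[OF dense] using n_symmetric True
      by (simp add: n_def D_def)
    moreover have "(A \<circ>\<^sub>m B) x = Some (n x)" using True by (auto simp: n_def D_def)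
    ultimately show ?thesis by simp
  next
    case False
    then have "x \<notin> dom (A \<circ>\<^sub>m B)" "x \<notin> dom (adjoint_operator (A \<circ>\<^sub>m B))"
      using normal_operator_dom_adjoint[OF AB_normal] by (simp_all add: D_def)
    then show ?thesis by (simp add: domIff)
  qed
  then have "A \<circ>\<^sub>m B = adjoint_operator (A \<circ>\<^sub>m B)" by (rule ext)
  with dense lin show ?thesis unfolding self_adjoint_def by blast
qed

section \<open>The closure of \<open>BA\<close>\<close>

lemma BA_subset_AB:
  assumes x: "x \<in> dom A"
  shows "x \<in> D" "n x = b (a x)"
proof -
  \<comment> \<open>Moving \<open>A\<close> and then \<open>B\<close> across shows that the adjoint
    of \<open>AB\<close> extends \<open>BA\<close>; symmetry identifies this adjoint with
    \<open>n\<close>.\<close>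
  have pair: "cinner (n y) x = cinner y (b (a x))" if "y \<in> D" for y
    using that x a_pairing[of "b y" x] by (simp add: mem_D n_eq b_pairing)
  then have xD: "x \<in> D" and n': "n' x = b (a x)" using N.adjoint_iff by blast+
  have "\<forall>y\<in>D. cinner (n y) x = cinner y (n x)" using n_symmetric xD by blast
  then have "n' x = n x" using N.adjoint_iff by blast
  with xD n' show "x \<in> D" "n x = b (a x)" by auto
qed

lemma graph_BA: "Map.graph (B \<circ>\<^sub>m A) = (\<lambda>x. (x, n x)) ` dom A"
proof -
  have "(B \<circ>\<^sub>m A) x = Some y \<longleftrightarrow> x \<in> dom A \<and> y = n x" for x y
    using BA_subset_AB(2)[of x] by (cases "A x") (auto simp: map_comp_def B_eq a_def domIff)
  then show ?thesis by (auto simp: Map.graph_def image_iff)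
qed

lemma graph_AB: "Map.graph (A \<circ>\<^sub>m B) = (\<lambda>x. (x, n x)) ` D"
  by (simp add: graph_eq_image n_def D_def)

text \<open>If \<open>(x, n x)\<close> is orthogonal to the graph of \<open>BA\<close>, then \<open>n (n x) = - x\<close>, so \<open>x = 0\<close> by
  symmetry of \<open>n\<close>.\<close>

lemma closure_graph_BA: "closure (Map.graph (B \<circ>\<^sub>m A)) = Map.graph (A \<circ>\<^sub>m B)"
proof
  have sub: "dom A \<subseteq> D" using BA_subset_AB(1) by blast
  then have sub_graph: "(\<lambda>x. (x, n x)) ` dom A \<subseteq> (\<lambda>x. (x, n x)) ` D" by blast
  show "closure (Map.graph (B \<circ>\<^sub>m A)) \<subseteq> Map.graph (A \<circ>\<^sub>m B)"
    unfolding graph_BA graph_AB by (rule closure_minimal[OF sub_graph N.closed_graph])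
  show "Map.graph (A \<circ>\<^sub>m B) \<subseteq> closure (Map.graph (B \<circ>\<^sub>m A))"
    unfolding graph_BA graph_AB
  proof (rule subset_closure_of_orthogonal_trivial[OF _ N.subspace_graph N.closed_graph sub_graph])
    show "subspace ((\<lambda>x. (x, n x)) ` dom A)"
      by (rule N.subspace_graph_on[OF sub A.zero_mem A.add_mem A.scale_mem])
    fix w assume "w \<in> (\<lambda>x. (x, n x)) ` D"
      and orth: "\<And>v. v \<in> (\<lambda>x. (x, n x)) ` dom A \<Longrightarrow> inner w v = 0"
    then obtain x where x: "x \<in> D" "w = (x, n x)" by blast
    have re: "inner v x + inner (n v) (n x) = 0" if "v \<in> dom A" for v
      using orth[of "(v, n v)"] that x(2) by (simp add: inner_commute)
    have "cinner (a v) (b (n x)) = cinner v (- x)" if v: "v \<in> dom A" for v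
    proof -
      have "inner v x + inner (n v) (n x) = 0" by (rule re[OF v])
      \<comment> \<open>\<open>dom A\<close> is closed under multiplication by \<open>\<i>\<close>,
        so the real orthogonality relation has a rotated copy that supplies the imaginary
        part.\<close>
      moreover have "inner (\<i> *\<^sub>C v) x + inner (\<i> *\<^sub>C n v) (n x) = 0"
        using re[OF A.scale_mem[OF v], of \<i>] BA_subset_AB(1)[OF v] by (simp add: N.t_scale)
      moreover have "inner (\<i> *\<^sub>C u) w = - inner u (\<i> *\<^sub>C w)" for u w :: 'a
        using inner_ii_ii[of u "\<i> *\<^sub>C w"]
        by (simp add: scaleC_scaleC scaleC_minus_one inner_commute)
      ultimately have "cinner v x + cinner (n v) (n x) = 0"
        by (simp add: cinner_eq_Complex complex_eq_iff)
      then have "cinner (n v) (n x) = cinner v (- x)"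
        using cinner_diff_right[of v 0 x] by (simp add: cinner_zero_right add_eq_0_iff)
      then show ?thesis by (simp add: BA_subset_AB(2)[OF v] b_pairing)
    qed
    \<comment> \<open>Self-adjointness of \<open>A\<close> produces the membership of
      \<open>b (n x)\<close> in \<open>dom A\<close>, not only the value there.\<close>
    then have "A (b (n x)) = Some (- x)" by (simp add: a_adjoint)
    then have nx: "n x \<in> D" "n (n x) = - x" by (auto simp: mem_D n_eq a_def)
    have "cinner (n x) (n x) = cinner x (- x)"
      using n_symmetric[OF x(1) nx(1)] nx(2) by simp
    then have "inner (n x) (n x) = inner x (- x)" by (simp add: inner_eq_Re_cinner)
    then have "inner (n x) (n x) + inner x x = 0" by simp
    then have "inner x x = 0" using inner_ge_zero[of x] inner_ge_zero[of "n x"] by linarith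
    then show "w = 0" using x(2) N.t_zero by (simp add: zero_prod_def)
  qed
qed

lemma closable_BA: "closable (B \<circ>\<^sub>m A)"
  unfolding closable_def closure_graph_BA by (auto simp: single_valued_def Map.graph_def)

lemma operator_closure_BA: "operator_closure (B \<circ>\<^sub>m A) = A \<circ>\<^sub>m B"
proof
  fix x
  have "operator_closure (B \<circ>\<^sub>m A) x = Some y \<longleftrightarrow> (A \<circ>\<^sub>m B) x = Some y" for y
    using graph_operator_closure[OF closable_BA, unfolded closure_graph_BA]
    by (auto simp: Map.graph_def set_eq_iff)
  then show "operator_closure (B \<circ>\<^sub>m A) x = (A \<circ>\<^sub>m B) x"
    by (metis option.exhaust)
qed

end

theorem theorem2p5:
  fixes A B :: "'a::chilbert_space \<rightharpoonup> 'a"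
  assumes "bounded_operator B" and "self_adjoint B"
    and "self_adjoint A" and "positive_operator A"
    and "normal_operator (A \<circ>\<^sub>m B)"
  shows "closable (B \<circ>\<^sub>m A) \<and>
    self_adjoint (operator_closure (B \<circ>\<^sub>m A)) \<and> self_adjoint (A \<circ>\<^sub>m B) \<and>
    A \<circ>\<^sub>m B = operator_closure (B \<circ>\<^sub>m A)"
proof -
  interpret positive_product A B using assms by (rule positive_product.intro)
  show ?thesis
    using closable_BA self_adjoint_AB by (simp add: operator_closure_BA)
qed

end
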